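(* Let $t\in[0,n-2]$ and let $W_t=x_1^{j_1}\cdots x_{n-1}^{j_{n-1}}\in B_x$ satisfy $$j_1+1\ge j_2+2\ge\cdots\ge j_t+t\ge\max\{j_k+k\mid k\in[t+1,n-1]\}$$ (no condition if $t=0$). Let $k\in[t+1,n-1]$ be the smallest index such that $j_k+k=\max\{j_l+l\mid l\in[t+1,n-1]\}$, and define $$v^{W_t}_{t+1}=s_{k-1,t+1},\qquad W_{t+1}=x_1^{j_1}\cdots x_t^{j_t}\cdot x_{t+1}^{j_k+k-t-1}\cdot\prod_{l\in[t+2,k]}x_l^{j_{l-1}}\cdot x_{k+1}^{j_{k+1}}\cdots x_{n-1}^{j_{n-1}}.$$ Then $\overline{\partial_{v^{W_t}_{t+1}}\mathfrak{S}_{W_{t+1}}}=W_t$. In particular, for any $W_0\in B_x$, applying this construction successively for $t=0,1,\ldots,n-3$ one can construct $v^{W_0}_1,W_1,\ldots,v^{W_{n-3}}_{n-2},W_{n-2}$ such that $\overline{\partial_{v^{W_{i-1}}_i}\mathfrak{S}_{W_i}}=W_{i-1}$ for each $i$, which implies $$\overline{\partial_{v^{W_0}_1}\cdots\partial_{v^{W_{n-4}}_{n-3}}\partial_{v^{W_{n-3}}_{n-2}}\mathfrak{S}_{W_{n-2}}}=W_0.$$ Moreover, if $W_i=x_1^{l_{i,1}}\cdots x_{n-1}^{l_{i,n-1}}$, then $l_{i,1}+1\ge l_{i,2}+2\ge\cdots\ge l_{i,i}+i\ge\max\{l_{i,k}+k\mid k\in[i+1,n-1]\}$.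
   Context: $[i,j]=\{i,\ldots,j\}$ if $i\le j$ and $\emptyset$ otherwise. $S_n$ is generated by $s_1,\ldots,s_{n-1}$, $s_i=(i,i+1)$. For $j\le i$, $s_{i,j}$ is the word $s_is_{i-1}\cdots s_j$; $s_{i,j}=1$ (empty word) if $j>i$. $s_if$ is the result of interchanging $x_i,x_{i+1}$ in the polynomial $f$, $\partial_i(f)=\frac{f-s_if}{x_i-x_{i+1}}$; for a word $w=s_{a_1}\cdots s_{a_p}$, $\partial_w=\partial_{a_1}\cdots\partial_{a_p}$ (identity for the empty word). For $u\in S_n$, $\partial_u$ is $\partial_w$ for any reduced word $w$ of $u$. $\mathfrak{S}_{w_0^n}=x_1^{n-1}x_2^{n-2}\cdots x_{n-1}$. $B_x=\{x_1^{k_1}\cdots x_{n-1}^{k_{n-1}}\mid k_i\ge0,\ k_i+i\le n,\ 1\le i\le n-1\}$. Monomial order: for $U=x_1^{k_1}\cdots x_{n-1}^{k_{n-1}}$, $V=x_1^{l_1}\cdots x_{n-1}^{l_{n-1}}$, $U<V$ iff $(\sum_ik_i,k_{n-1},\ldots,k_1)<(\sum_il_i,l_{n-1},\ldots,l_1)$ lexicographically; $\bar f$ is the leading (largest) monomial of $f$, without coefficient. The map $u\mapsto\overline{\partial_u\mathfrak{S}_{w_0^n}}$ is a bijection $S_n\to B_x$; for $W\in B_x$, $\mathfrak{S}_W:=\partial_u\mathfrak{S}_{w_0^n}$ where $u\in S_n$ is the unique element with $\overline{\partial_u\mathfrak{S}_{w_0^n}}=W$. *)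

theory Defs
  imports "HOL-Library.Poly_Mapping" "HOL-Combinatorics.Permutations"
begin

text \<open>
  Monomials are finitely supported exponent vectors, written additively, and polynomials are
  finitely supported maps from monomials to the integers. Variables are numbered from 1 as
  in \<open>x\<^sub>1, x\<^sub>2, \<dots>\<close>; the index 0 is never used. The ring has infinitely many
  variables, and \<open>n\<close> is a parameter of the definitions that depend on it.
\<close>

type_synonym monomial = "nat \<Rightarrow>\<^sub>0 nat"
type_synonym polynomial = "monomial \<Rightarrow>\<^sub>0 int"

abbreviation expo :: "monomial \<Rightarrow> nat \<Rightarrow> nat"
  where "expo \<equiv> Poly_Mapping.lookup"

abbreviation var_pow :: "nat \<Rightarrow> nat \<Rightarrow> monomial"
  where "var_pow i k \<equiv> Poly_Mapping.single i k"

definition var :: "nat \<Rightarrow> polynomial"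
  where "var i = Poly_Mapping.single (var_pow i 1) 1"


subsection \<open>Divided differences\<close>

text \<open>
  \<^const>\<open>Poly_Mapping.map_key\<close> precomposes with an injective map; both maps below are involutions.
\<close>

definition swap_mon :: "nat \<Rightarrow> monomial \<Rightarrow> monomial"
  where "swap_mon i = Poly_Mapping.map_key (transpose i (Suc i))"

definition swap_poly :: "nat \<Rightarrow> polynomial \<Rightarrow> polynomial"
  where "swap_poly i = Poly_Mapping.map_key (swap_mon i)"

text \<open>
  The quotient exists, and it is unique because the polynomial ring is an integral domain.
\<close>

definition div_diff :: "nat \<Rightarrow> polynomial \<Rightarrow> polynomial"
  where "div_diff i f = (THE g. (var i - var (Suc i)) * g = f - swap_poly i f)"

text \<open>A word \<open>s\<^sub>a \<cdots> s\<^sub>b\<close> is the list of its indices \<open>[a, \<dots>, b]\<close>.\<close>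

definition div_diff_word :: "nat list \<Rightarrow> polynomial \<Rightarrow> polynomial"
  where "div_diff_word w f = foldr div_diff w f"

definition desc_word :: "nat \<Rightarrow> nat \<Rightarrow> nat list"
  where "desc_word i j = rev [j..<Suc i]"

definition word_perm :: "nat list \<Rightarrow> nat \<Rightarrow> nat"
  where "word_perm w = foldr (\<lambda>a p. transpose a (Suc a) \<circ> p) w id"

definition reduced_word :: "nat \<Rightarrow> (nat \<Rightarrow> nat) \<Rightarrow> nat list \<Rightarrow> bool"
  where "reduced_word n u w \<longleftrightarrow>
    set w \<subseteq> {1..n - 1} \<and> word_perm w = u \<and>
    (\<forall>w'. set w' \<subseteq> {1..n - 1} \<and> word_perm w' = u \<longrightarrow> length w \<le> length w')"

text \<open>
  For \<open>u permutes {1..n}\<close> a reduced word exists, and by the braid relations the operator does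
  not depend on which one is chosen.
\<close>

definition div_diff_perm :: "nat \<Rightarrow> (nat \<Rightarrow> nat) \<Rightarrow> polynomial \<Rightarrow> polynomial"
  where "div_diff_perm n u = div_diff_word (SOME w. reduced_word n u w)"


subsection \<open>Leading monomials and Schubert polynomials\<close>

definition B_x :: "nat \<Rightarrow> monomial set"
  where "B_x n = {U. Poly_Mapping.keys U \<subseteq> {1..n - 1} \<and> (\<forall>i\<in>{1..n - 1}. expo U i + i \<le> n)}"

text \<open>The tuple \<open>(\<Sum>k\<^sub>i, k\<^sub>n\<^sub>-\<^sub>1, \<dots>, k\<^sub>1)\<close>, for monomials in \<open>x\<^sub>1, \<dots>, x\<^sub>n\<^sub>-\<^sub>1\<close>.\<close>

definition mon_tuple :: "nat \<Rightarrow> monomial \<Rightarrow> nat list"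
  where "mon_tuple n U = (\<Sum>i\<in>{1..n - 1}. expo U i) # rev (map (expo U) [1..<n])"

definition mon_less :: "nat \<Rightarrow> monomial \<Rightarrow> monomial \<Rightarrow> bool"
  where "mon_less n U V \<longleftrightarrow> (mon_tuple n U, mon_tuple n V) \<in> lexord {(a, b). a < b}"

text \<open>
  \<open>has_leading_mon n f U\<close> reads: the leading monomial of \<open>f\<close> exists and is \<open>U\<close>. In particular it
  fails for \<open>f = 0\<close>.
\<close>

definition has_leading_mon :: "nat \<Rightarrow> polynomial \<Rightarrow> monomial \<Rightarrow> bool"
  where "has_leading_mon n f U \<longleftrightarrow>
    U \<in> Poly_Mapping.keys f \<and> (\<forall>V\<in>Poly_Mapping.keys f. V \<noteq> U \<longrightarrow> mon_less n V U)"

definition schubert_w0 :: "nat \<Rightarrow> polynomial"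
  where "schubert_w0 n = (\<Prod>i\<in>{1..n - 1}. var i ^ (n - i))"

text \<open>
  The description is meant for \<open>W \<in> B_x n\<close>, where exactly one such permutation exists.
\<close>

definition schubert_perm :: "nat \<Rightarrow> monomial \<Rightarrow> nat \<Rightarrow> nat"
  where "schubert_perm n W =
    (THE u. u permutes {1..n} \<and> has_leading_mon n (div_diff_perm n u (schubert_w0 n)) W)"

definition schubert :: "nat \<Rightarrow> monomial \<Rightarrow> polynomial"
  where "schubert n W = div_diff_perm n (schubert_perm n W) (schubert_w0 n)"


subsection \<open>The construction\<close>

definition max_height :: "nat \<Rightarrow> nat \<Rightarrow> monomial \<Rightarrow> nat"
  where "max_height n t W = Max ((\<lambda>l. expo W l + l) ` {t + 1..n - 1})"

definition ordered_upto :: "nat \<Rightarrow> nat \<Rightarrow> monomial \<Rightarrow> bool"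
  where "ordered_upto n t W \<longleftrightarrow>
    (\<forall>i\<in>{1..<t}. expo W i + i \<ge> expo W (i + 1) + (i + 1)) \<and>
    (t \<ge> 1 \<longrightarrow> expo W t + t \<ge> max_height n t W)"

definition pivot :: "nat \<Rightarrow> nat \<Rightarrow> monomial \<Rightarrow> nat"
  where "pivot n t W = (LEAST k. k \<in> {t + 1..n - 1} \<and> expo W k + k = max_height n t W)"

definition step_word :: "nat \<Rightarrow> nat \<Rightarrow> monomial \<Rightarrow> nat list"
  where "step_word n t W = desc_word (pivot n t W - 1) (t + 1)"

definition step_mon :: "nat \<Rightarrow> nat \<Rightarrow> monomial \<Rightarrow> monomial"
  where "step_mon n t W =
    (let k = pivot n t W in
      (\<Sum>l\<in>{1..t}. var_pow l (expo W l))
      + var_pow (t + 1) (expo W k + k - t - 1)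
      + (\<Sum>l\<in>{t + 2..k}. var_pow l (expo W (l - 1)))
      + (\<Sum>l\<in>{k + 1..n - 1}. var_pow l (expo W l)))"

text \<open>
  The monomials \<open>W\<^sub>0, W\<^sub>1, \<dots>\<close> obtained from \<open>W\<^sub>0\<close>, and the words \<open>v\<^sub>1, v\<^sub>2, \<dots>\<close>,
  where \<open>v\<^sub>i\<close> (for \<open>i \<ge> 1\<close>) belongs to the step from \<open>W\<^sub>i\<^sub>-\<^sub>1\<close> to \<open>W\<^sub>i\<close>.
\<close>

primrec W_seq :: "nat \<Rightarrow> monomial \<Rightarrow> nat \<Rightarrow> monomial"
  where
    "W_seq n W0 0 = W0"
  | "W_seq n W0 (Suc t) = step_mon n t (W_seq n W0 t)"

definition v_seq :: "nat \<Rightarrow> monomial \<Rightarrow> nat \<Rightarrow> nat list"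
  where "v_seq n W0 i = step_word n (i - 1) (W_seq n W0 (i - 1))"

end

theory Submission
  imports Defs
begin

text \<open>
  The code of a permutation \<open>\<pi>\<close> is \<open>c\<^sub>i = #{j > i. \<pi>(j) < \<pi>(i)}\<close>. The key fact is that
  \<open>\<partial>\<^sub>u\<SS>\<^bsub>w\<^sub>0\<^esub>\<close> has leading monomial \<open>x\<^sup>c\<close> with \<open>c\<close> the code of \<open>w\<^sub>0u\<^sup>-\<^sup>1\<close>.
  A right multiplication by \<open>s\<^sub>i\<close> acts on codes by \<open>(c\<^sub>i, c\<^sub>i\<^sub>+\<^sub>1) \<mapsto> (c\<^sub>i\<^sub>+\<^sub>1, c\<^sub>i - 1)\<close> at a
  descent \<open>c\<^sub>i > c\<^sub>i\<^sub>+\<^sub>1\<close>, so the divided differences can be followed on codes alone. If \<open>m\<close> is the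
  last position with \<open>c\<^sub>m > 0\<close>, the polynomial \<open>f\<close> with code \<open>c\<close> involves only \<open>x\<^sub>1, \<dots>, x\<^sub>m\<close>, and
  \<open>\<partial>\<^bsub>m+p-1\<^esub> \<cdots> \<partial>\<^sub>m f\<close> reads off the coefficients of the powers of \<open>x\<^sub>m\<close> from \<open>p\<close> on; it
  vanishes for \<open>p > c\<^sub>m\<close>, and for \<open>p = c\<^sub>m\<close> it is the polynomial whose code is \<open>c\<close> with \<open>c\<^sub>m\<close>
  replaced by 0. Induction on \<open>m\<close> gives the leading monomial. The word \<open>s\<^bsub>k-1,t+1\<^esub>\<close> acts on the
  code \<open>W\<^sub>t\<^sub>+\<^sub>1\<close> by \<open>k - 1 - t\<close> descents that lead to \<open>W\<^sub>t\<close>.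
\<close>

section \<open>Divided differences\<close>

abbreviation coeff :: "polynomial \<Rightarrow> monomial \<Rightarrow> int"
  where "coeff \<equiv> Poly_Mapping.lookup"


section \<open>Interchange of two adjacent variables\<close>

lemma lookup_swap_mon: "expo (swap_mon i U) j = expo U (transpose i (Suc i) j)"
  unfolding swap_mon_def by (simp add: map_key.rep_eq)

lemma swap_mon_swap_mon [simp]: "swap_mon i (swap_mon i U) = U"
  by (rule poly_mapping_eqI) (simp add: lookup_swap_mon)

lemma inj_swap_mon: "inj (swap_mon i)"
  by (metis injI swap_mon_swap_mon)

lemma swap_mon_add: "swap_mon i (U + V) = swap_mon i U + swap_mon i V"
  by (rule poly_mapping_eqI) (simp add: lookup_swap_mon lookup_add)

lemma swap_mon_var_pow: "swap_mon i (var_pow j k) = var_pow (transpose i (Suc i) j) k"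
  by (rule poly_mapping_eqI) (auto simp: lookup_swap_mon lookup_single when_def)

lemma lookup_swap_poly: "coeff (swap_poly i f) U = coeff f (swap_mon i U)"
  unfolding swap_poly_def by (simp add: map_key.rep_eq[OF inj_swap_mon])

lemma swap_poly_swap_poly [simp]: "swap_poly i (swap_poly i f) = f"
  by (rule poly_mapping_eqI) (simp add: lookup_swap_poly)

lemma swap_poly_0 [simp]: "swap_poly i 0 = 0"
  by (rule poly_mapping_eqI) (simp add: lookup_swap_poly)

lemma swap_poly_diff: "swap_poly i (f - g) = swap_poly i f - swap_poly i g"
  by (rule poly_mapping_eqI) (simp add: lookup_swap_poly lookup_minus)

lemma swap_poly_single: "swap_poly i (Poly_Mapping.single m c) = Poly_Mapping.single (swap_mon i m) c"
  unfolding swap_poly_def by (metis inj_swap_mon map_key_single swap_mon_swap_mon)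

lemma swap_poly_var: "swap_poly i (var j) = var (transpose i (Suc i) j)"
  by (simp add: var_def swap_poly_single swap_mon_var_pow)

text \<open>Integer polynomials form the free abelian group on the monomials, so additive statements
  need only be checked on monomials.\<close>

lemma polynomial_induct [case_names zero monomial diff]:
  fixes f :: polynomial
  assumes "P 0"
    and "\<And>m. P (Poly_Mapping.single m 1)" "\<And>f g. P f \<Longrightarrow> P g \<Longrightarrow> P (f - g)"
  shows "P f"
  using frag_induction[of f UNIV P] assms by auto

lemma swap_poly_mult: "swap_poly i (f * g) = swap_poly i f * swap_poly i g"
proof (induction f rule: polynomial_induct)
  case (monomial m)
  show ?case
  proof (induction g rule: polynomial_induct)
    case (monomial m')
    show ?case by (simp add: mult_single swap_poly_single swap_mon_add)
  qed (simp_all add: swap_poly_diff right_diff_distrib)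
qed (simp_all add: swap_poly_diff left_diff_distrib)

lemma swap_poly_braid:
  "swap_poly i (swap_poly (Suc i) (swap_poly i f)) = swap_poly (Suc i) (swap_poly i (swap_poly (Suc i) f))"
proof (rule poly_mapping_eqI)
  fix U
  have "swap_mon i (swap_mon (Suc i) (swap_mon i U)) = swap_mon (Suc i) (swap_mon i (swap_mon (Suc i) U))"
    by (rule poly_mapping_eqI) (auto simp: lookup_swap_mon transpose_def)
  then show "coeff (swap_poly i (swap_poly (Suc i) (swap_poly i f))) U =
      coeff (swap_poly (Suc i) (swap_poly i (swap_poly (Suc i) f))) U"
    by (simp add: lookup_swap_poly)
qed

lemma swap_poly_commute:
  assumes "Suc i < j"
  shows "swap_poly i (swap_poly j f) = swap_poly j (swap_poly i f)"
proof (rule poly_mapping_eqI)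
  fix U
  have "swap_mon j (swap_mon i U) = swap_mon i (swap_mon j U)"
    using assms by (intro poly_mapping_eqI) (auto simp: lookup_swap_mon transpose_def)
  then show "coeff (swap_poly i (swap_poly j f)) U = coeff (swap_poly j (swap_poly i f)) U"
    by (simp add: lookup_swap_poly)
qed

lemma single_var_pow: "Poly_Mapping.single (var_pow j k) 1 = var j ^ k"
proof (induction k)
  case (Suc k)
  have "var_pow j (Suc k) = var_pow j 1 + var_pow j k"
    by (simp flip: single_add)
  then have "Poly_Mapping.single (var_pow j (Suc k)) (1::int) =
      Poly_Mapping.single (var_pow j 1) 1 * Poly_Mapping.single (var_pow j k) 1"
    by (simp only: mult_single mult_1)
  then show ?case by (simp only: power_Suc Suc var_def)
qed simp

lemma var_neq: "i \<noteq> j \<Longrightarrow> var i - var j \<noteq> 0"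
proof
  assume "i \<noteq> j" "var i - var j = 0"
  then have "var_pow i 1 = var_pow j 1"
    by (simp add: var_def frag_of_eq)
  then show False
    using \<open>i \<noteq> j\<close> by (metis lookup_single_eq lookup_single_not_eq zero_neq_one)
qed

text \<open>The twisted Leibniz rule
  \<open>f * g - s (f * g) = (f - s f) * g + s f * (g - s g)\<close> carries divisibility over to
  products. It is clear for variables, hence holds for powers, monomials and, additively, all
  polynomials.\<close>

lemma var_diff_dvd: "var i - var (Suc i) dvd f - swap_poly i f"
proof -
  let ?d = "var i - var (Suc i)"
  have mult: "?d dvd f * g - swap_poly i (f * g)"
    if "?d dvd f - swap_poly i f" "?d dvd g - swap_poly i g" for f g
  proof -
    have "f * g - swap_poly i (f * g) =
        (f - swap_poly i f) * g + swap_poly i f * (g - swap_poly i g)"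
      by (simp add: swap_poly_mult algebra_simps)
    then show ?thesis using that by (metis dvd_add dvd_mult dvd_mult2)
  qed
  have var: "?d dvd var j - swap_poly i (var j)" for j
  proof -
    have "?d dvd var (Suc i) - var i"
      by (metis dvd_minus_iff dvd_refl minus_diff_eq)
    then show ?thesis by (auto simp: swap_poly_var transpose_def)
  qed
  have one: "swap_poly i 1 = 1"
    by (metis single_one swap_poly_single swap_mon_var_pow single_zero)
  have pow: "?d dvd Poly_Mapping.single (var_pow j k) 1 - swap_poly i (Poly_Mapping.single (var_pow j k) 1)" for j k
    unfolding single_var_pow by (induction k) (auto simp: one intro: mult var)
  have mon: "?d dvd Poly_Mapping.single m 1 - swap_poly i (Poly_Mapping.single m 1)" for m
  proof (induction m rule: update_induct)
    case const
    show ?case by (simp add: one)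
  next
    case (update m a b)
    have "Poly_Mapping.update a b m = var_pow a b + m"
      using update(1) by (intro poly_mapping_eqI)
        (auto simp: lookup_update lookup_add lookup_single when_def in_keys_iff)
    then have "Poly_Mapping.single (Poly_Mapping.update a b m) 1 =
        Poly_Mapping.single (var_pow a b) 1 * (Poly_Mapping.single m 1 :: polynomial)"
      by (simp add: mult_single)
    then show ?case using mult pow update by metis
  qed
  show ?thesis
  proof (induction f rule: polynomial_induct)
    case (diff f g)
    have "f - g - swap_poly i (f - g) = (f - swap_poly i f) - (g - swap_poly i g)"
      by (simp add: swap_poly_diff)
    then show ?case using diff by (metis dvd_diff)
  qed (auto simp: mon)
qed

section \<open>Divided differences: symmetry, commutation and braid relations\<close>

lemma div_diff_eqI:
  assumes "(var i - var (Suc i)) * g = f - swap_poly i f"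
  shows "div_diff i f = g"
  unfolding div_diff_def
proof (rule the_equality)
  fix g' assume "(var i - var (Suc i)) * g' = f - swap_poly i f"
  then have "(var i - var (Suc i)) * g' = (var i - var (Suc i)) * g" using assms by simp
  then show "g' = g" using var_neq[of i "Suc i"] mult_left_cancel by (metis n_not_Suc_n)
qed (fact assms)

lemma div_diff_mult: "(var i - var (Suc i)) * div_diff i f = f - swap_poly i f"
proof -
  obtain g where "(var i - var (Suc i)) * g = f - swap_poly i f"
    using var_diff_dvd[of i f] by (metis dvdE)
  then show ?thesis using div_diff_eqI by metis
qed

lemma div_diff_eq_0_iff: "div_diff i f = 0 \<longleftrightarrow> swap_poly i f = f"
  using div_diff_mult[of i f] var_neq[of i "Suc i"] div_diff_eqI[of i 0 f] by auto

lemma swap_div_diff: "swap_poly i (div_diff i f) = div_diff i f"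
proof (rule div_diff_eqI[symmetric])
  have "swap_poly i ((var i - var (Suc i)) * div_diff i f) = swap_poly i (f - swap_poly i f)"
    by (simp only: div_diff_mult)
  then have "(var (Suc i) - var i) * swap_poly i (div_diff i f) = swap_poly i f - f"
    by (simp add: swap_poly_mult swap_poly_diff swap_poly_var)
  then show "(var i - var (Suc i)) * swap_poly i (div_diff i f) = f - swap_poly i f"
    by algebra
qed

lemma div_diff_div_diff: "div_diff i (div_diff i f) = 0"
  by (simp add: div_diff_eq_0_iff swap_div_diff)

text \<open>Each linear form is fixed by the other swap. Multiplied by both forms, the two sides
  become the same alternating sum over the two commuting swaps.\<close>

lemma div_diff_commute:
  assumes "Suc i < j"
  shows "div_diff i (div_diff j f) = div_diff j (div_diff i f)"
proof -
  let ?D = "var i - var (Suc i)" and ?E = "var j - var (Suc j)"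
  let ?s = "swap_poly i" and ?t = "swap_poly j"
  have D: "?t (?D * g) = ?D * ?t g" and E: "?s (?E * g) = ?E * ?s g" for g
    using assms by (auto simp: swap_poly_mult swap_poly_diff swap_poly_var transpose_def)
  have "?D * ?E * div_diff i (div_diff j f) = f - ?t f - ?s (f - ?t f)"
    using div_diff_mult[of i "div_diff j f"] div_diff_mult[of j f] E[of "div_diff j f"] by algebra
  also have "\<dots> = f - ?s f - ?t (f - ?s f)"
    by (simp add: swap_poly_diff swap_poly_commute[OF assms])
  also have "\<dots> = ?D * ?E * div_diff j (div_diff i f)"
    using div_diff_mult[of j "div_diff i f"] div_diff_mult[of i f] D[of "div_diff i f"] by algebra
  finally show ?thesis
    using var_neq[of i "Suc i"] var_neq[of j "Suc j"] by auto
qed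

text \<open>Multiplied by the Vandermonde product \<open>?V\<close>, both sides become the
  alternating sum of the six images of \<open>f\<close>. The expansions differ only in how the
  longest element is written, which \<open>swap_poly_braid\<close> settles.\<close>

lemma div_diff_braid:
  "div_diff i (div_diff (Suc i) (div_diff i f)) = div_diff (Suc i) (div_diff i (div_diff (Suc i) f))"
proof -
  let ?x = "var i" and ?y = "var (Suc i)" and ?z = "var (Suc (Suc i))"
  let ?s = "swap_poly i" and ?t = "swap_poly (Suc i)"
  let ?D = "div_diff i" and ?E = "div_diff (Suc i)"
  note sv = swap_poly_mult swap_poly_diff swap_poly_var transpose_def
  have D: "(?x - ?y) * ?D g = g - ?s g" and E: "(?y - ?z) * ?E g = g - ?t g" for g
    by (rule div_diff_mult)+
  \<comment> \<open>This and the next three facts are images of the defining equations under swaps,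
    which permute the linear factors.\<close>
  have tD: "(?x - ?z) * ?t (?D g) = ?t g - ?t (?s g)" for g
    using arg_cong[OF D[of g], of ?t] by (simp add: sv)
  have stD: "(?y - ?z) * ?s (?t (?D g)) = ?s (?t g) - ?s (?t (?s g))" for g
    using arg_cong[OF tD[of g], of ?s] by (simp add: sv)
  have sE: "(?x - ?z) * ?s (?E g) = ?s g - ?s (?t g)" for g
    using arg_cong[OF E[of g], of ?s] by (simp add: sv)
  have tsE: "(?x - ?y) * ?t (?s (?E g)) = ?t (?s g) - ?t (?s (?t g))" for g
    using arg_cong[OF sE[of g], of ?t] by (simp add: sv)
  let ?V = "(?x - ?y) * (?y - ?z) * (?x - ?z)"
  have "?V * ?D (?E (?D f)) = f - ?s f - ?t f + ?t (?s f) + ?s (?t f) - ?s (?t (?s f))"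
    using D[of "?E (?D f)"] E[of "?D f"] sE[of "?D f"] D[of f] tD[of f] stD[of f] swap_div_diff[of i f]
    by algebra
  moreover have "?V * ?E (?D (?E f)) = f - ?s f - ?t f + ?t (?s f) + ?s (?t f) - ?t (?s (?t f))"
    using E[of "?D (?E f)"] D[of "?E f"] tD[of "?E f"] E[of f] sE[of f] tsE[of f] swap_div_diff[of "Suc i" f]
    by algebra
  ultimately have "?V * ?D (?E (?D f)) = ?V * ?E (?D (?E f))"
    by (simp add: swap_poly_braid)
  then show ?thesis
    using var_neq[of i "Suc i"] var_neq[of "Suc i" "Suc (Suc i)"] var_neq[of i "Suc (Suc i)"]
    by auto
qed

lemma lookup_var_mult:
  "coeff (var i * g) U = (if expo U i = 0 then 0 else coeff g (U - var_pow i 1))"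
proof (induction g rule: polynomial_induct)
  case (monomial m)
  have "var_pow i 1 + m = U \<longleftrightarrow> expo U i \<noteq> 0 \<and> m = U - var_pow i 1"
  proof
    assume "expo U i \<noteq> 0 \<and> m = U - var_pow i 1"
    then show "var_pow i 1 + m = U"
      by (intro poly_mapping_eqI) (auto simp: lookup_add lookup_minus lookup_single when_def)
  qed (auto simp: lookup_add)
  moreover have "var i * Poly_Mapping.single m 1 = Poly_Mapping.single (var_pow i 1 + m) 1"
    by (simp add: var_def mult_single)
  ultimately show ?case by auto
qed (auto simp: right_diff_distrib lookup_minus)

section \<open>Codes\<close>

definition staircase :: "nat \<Rightarrow> nat \<Rightarrow> nat"
  where "staircase n j = (if j = 0 then 0 else n - j)"

definition is_code :: "nat \<Rightarrow> (nat \<Rightarrow> nat) \<Rightarrow> bool"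
  where "is_code n c \<longleftrightarrow> (\<forall>j. c j \<le> staircase n j)"

text \<open>
  The effect on codes of a right multiplication by \<open>s\<^sub>i\<close>; the second case is an ascent.
\<close>

definition code_act :: "nat \<Rightarrow> (nat \<Rightarrow> nat) \<Rightarrow> nat \<Rightarrow> nat"
  where "code_act i c =
    (if c (Suc i) < c i then c(i := c (Suc i), Suc i := c i - 1)
     else c(i := Suc (c (Suc i)), Suc i := c i))"

text \<open>For the code of a permutation this is its number of inversions. The deficit against the
  staircase counts divided differences.\<close>

definition code_sum :: "nat \<Rightarrow> (nat \<Rightarrow> nat) \<Rightarrow> nat"
  where "code_sum n c = (\<Sum>j\<in>{1..n}. c j)"

text \<open>
  A relation rather than a function, because a code is reached from the staircase along several
  words; \<open>is_schubert_unique\<close> shows that the polynomial does not depend on the word.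
\<close>

inductive is_schubert :: "nat \<Rightarrow> (nat \<Rightarrow> nat) \<Rightarrow> polynomial \<Rightarrow> bool" for n
  where
    top: "is_schubert n (staircase n) (schubert_w0 n)"
  | descent: "is_schubert n c f \<Longrightarrow> i \<in> {1..<n} \<Longrightarrow> c (Suc i) < c i \<Longrightarrow> is_schubert n (code_act i c) (div_diff i f)"

lemma code_act_act [simp]: "code_act i (code_act i c) = c"
  by (auto simp: code_act_def fun_eq_iff)

lemma code_act_commute: "Suc i < j \<Longrightarrow> code_act i (code_act j c) = code_act j (code_act i c)"
  by (auto simp: code_act_def fun_eq_iff)

text \<open>With ascents at both places, each side climbs through three ascents from
  \<open>(a, b, d)\<close> to \<open>(d + 2, b + 1, a)\<close>.\<close>

lemma code_act_braid:
  assumes "c i \<le> c (Suc i)" "c (Suc i) \<le> c (Suc (Suc i))"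
  shows "code_act i (code_act (Suc i) (code_act i c)) = code_act (Suc i) (code_act i (code_act (Suc i) c))"
  using assms by (auto simp: code_act_def fun_eq_iff)

lemma is_code_staircase: "is_code n (staircase n)"
  by (simp add: is_code_def)

lemma is_code_act:
  assumes "is_code n c" "i \<in> {1..<n}"
  shows "is_code n (code_act i c)"
proof -
  have le: "c j \<le> staircase n j" for j
    using assms(1) by (simp add: is_code_def)
  have "code_act i c j \<le> staircase n j" for j
    using le[of i] le[of "Suc i"] le[of j] assms(2)
    by (cases "j = i"; cases "j = Suc i") (auto simp: code_act_def staircase_def)
  then show ?thesis by (simp add: is_code_def)
qed

lemma code_sum_act:
  assumes "i \<in> {1..<n}"
  shows "code_sum n (code_act i c) = (if c (Suc i) < c i then code_sum n c - 1 else Suc (code_sum n c))"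
    and "c (Suc i) < c i \<Longrightarrow> 0 < code_sum n c"
proof -
  have "code_sum n d = d i + d (Suc i) + (\<Sum>j\<in>{1..n} - {i, Suc i}. d j)" for d
    using assms sum.subset_diff[of "{i, Suc i}" "{1..n}" d] by (simp add: code_sum_def)
  moreover have "(\<Sum>j\<in>{1..n} - {i, Suc i}. code_act i c j) = (\<Sum>j\<in>{1..n} - {i, Suc i}. c j)"
    by (intro sum.cong) (auto simp: code_act_def)
  ultimately show "code_sum n (code_act i c) = (if c (Suc i) < c i then code_sum n c - 1 else Suc (code_sum n c))"
    and "c (Suc i) < c i \<Longrightarrow> 0 < code_sum n c"
    by (auto simp: code_act_def)
qed

lemma code_sum_le: "is_code n c \<Longrightarrow> code_sum n c \<le> code_sum n (staircase n)"
  by (auto simp: code_sum_def is_code_def intro!: sum_mono)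

text \<open>Strict descents give \<open>c j \<ge> n - j\<close> by going down from \<open>n\<close>,
  which meets the upper bound. Every other code therefore has an ascent to climb.\<close>

lemma staircase_if_no_ascent:
  assumes "is_code n c" "\<And>i. i \<in> {1..<n} \<Longrightarrow> c (Suc i) < c i"
  shows "c = staircase n"
proof (rule ext, rule antisym)
  fix j
  show "c j \<le> staircase n j" using assms(1) by (simp add: is_code_def)
  have "n - j \<le> c j" if "1 \<le> j" "j \<le> n" for j
    using \<open>j \<le> n\<close> \<open>1 \<le> j\<close>
  proof (induction j rule: inc_induct)
    case (step k)
    then show ?case using assms(2)[of k] by auto
  qed simp
  then show "staircase n j \<le> c j" by (cases "j \<le> n") (auto simp: staircase_def)
qed

section \<open>Words leading down from the staircase\<close>

lemma code_sum_foldr_act: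
  "set w \<subseteq> {1..<n} \<Longrightarrow> code_sum n (staircase n) \<le> code_sum n (foldr code_act w (staircase n)) + length w"
proof (induction w)
  case (Cons i w)
  then show ?case
    using code_sum_act[of i n "foldr code_act w (staircase n)"] by (auto split: if_splits)
qed simp

text \<open>A letter lowers the sum by at most one. The word here is as short as this allows, so
  every letter meets a descent.\<close>

lemma is_schubert_foldr:
  assumes "set w \<subseteq> {1..<n}"
    and "code_sum n (foldr code_act w (staircase n)) + length w = code_sum n (staircase n)"
  shows "is_schubert n (foldr code_act w (staircase n)) (div_diff_word w (schubert_w0 n))"
  using assms
proof (induction w)
  case Nil
  show ?case by (simp add: div_diff_word_def is_schubert.top)
next
  case (Cons i w)
  let ?c = "foldr code_act w (staircase n)"
  have i: "i \<in> {1..<n}" and w: "set w \<subseteq> {1..<n}" using Cons.prems by auto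
  have "?c (Suc i) < ?c i \<and> code_sum n ?c + length w = code_sum n (staircase n)"
    using Cons.prems(2) code_sum_act[OF i, of ?c] code_sum_foldr_act[OF w]
    by (auto split: if_splits)
  then show ?case
    using Cons.IH[OF w] is_schubert.descent[OF _ i] by (simp add: div_diff_word_def)
qed

text \<open>Climbing at an ascent raises the sum by one and ends only at the staircase; the letters
  met on the way form the word.\<close>

lemma code_word_exists:
  assumes "is_code n c"
  shows "\<exists>w. set w \<subseteq> {1..<n} \<and> foldr code_act w (staircase n) = c \<and>
    code_sum n c + length w = code_sum n (staircase n)"
  using assms
proof (induction "code_sum n (staircase n) - code_sum n c" arbitrary: c rule: less_induct)
  case less
  show ?case
  proof (cases "c = staircase n")
    case True
    then show ?thesis by (intro exI[of _ "[]"]) simp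
  next
    case False
    then obtain i where i: "i \<in> {1..<n}" "c i \<le> c (Suc i)"
      using staircase_if_no_ascent[OF less.prems] by (meson not_le)
    have code: "is_code n (code_act i c)" using is_code_act less.prems i by blast
    have sum: "code_sum n (code_act i c) = Suc (code_sum n c)"
      using code_sum_act(1)[OF i(1), of c] i(2) by simp
    moreover have "code_sum n (code_act i c) \<le> code_sum n (staircase n)"
      using code_sum_le[OF code] .
    ultimately obtain w where w: "set w \<subseteq> {1..<n}" "foldr code_act w (staircase n) = code_act i c"
        "code_sum n (code_act i c) + length w = code_sum n (staircase n)"
      using less.hyps[OF _ code] by (metis Suc_le_lessD diff_less_mono2 lessI)
    then show ?thesis using i sum by (intro exI[of _ "i # w"]) auto
  qed
qed

lemma is_schubert_exists: "is_code n c \<Longrightarrow> \<exists>f. is_schubert n c f"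
  using code_word_exists is_schubert_foldr by metis

lemma is_schubert_is_code: "is_schubert n c f \<Longrightarrow> is_code n c"
  by (induction rule: is_schubert.induct) (simp_all add: is_code_staircase is_code_act)

lemma is_schubert_act:
  assumes "is_schubert n (code_act i c) f" "i \<in> {1..<n}" "c i \<le> c (Suc i)"
  shows "is_schubert n c (div_diff i f)"
proof -
  have "code_act i c (Suc i) < code_act i c i" using assms(3) by (simp add: code_act_def)
  then show ?thesis using is_schubert.descent[OF assms(1,2)] by simp
qed

lemma is_schubert_cases:
  assumes "is_schubert n c f"
  obtains "c = staircase n" "f = schubert_w0 n"
  | i g where "i \<in> {1..<n}" "c i \<le> c (Suc i)" "is_schubert n (code_act i c) g" "f = div_diff i g"
  using assms
proof (cases rule: is_schubert.cases)
  case (descent d g i)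
  have "c i \<le> c (Suc i)" using descent by (simp add: code_act_def)
  then show ?thesis using that(2)[of i g] descent by simp
qed (use that in auto)

text \<open>
  Any two covers of \<open>c\<close> have a common upper bound reached by a commutation or a braid move, as in
  the proof of Matsumoto's theorem.
\<close>

lemma is_schubert_unique:
  assumes "is_schubert n c f" "is_schubert n c g"
  shows "f = g"
  using assms
proof (induction "code_sum n (staircase n) - code_sum n c" arbitrary: c f g rule: less_induct)
  case less
  have top: "\<not> staircase n i \<le> staircase n (Suc i)" if "i \<in> {1..<n}" for i
    using that by (auto simp: staircase_def)
  have code: "is_code n c" using less.prems(1) by (rule is_schubert_is_code)
  have IH: "f' = g'" if "i \<in> {1..<n}" "c i \<le> c (Suc i)" "is_schubert n (code_act i c) f'" "is_schubert n (code_act i c) g'" for i f' g'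
    using less.hyps[OF _ that(3,4)] code_sum_act(1)[OF that(1), of c] that(2)
      code_sum_le[OF is_schubert_is_code[OF that(3)]] by simp
  have diamond: "div_diff i f' = div_diff j g'"
    if "i < j" and i: "i \<in> {1..<n}" "c i \<le> c (Suc i)" "is_schubert n (code_act i c) f'"
      and j: "j \<in> {1..<n}" "c j \<le> c (Suc j)" "is_schubert n (code_act j c) g'" for i j f' g'
  proof (cases "j = Suc i")
    case True
    let ?z = "code_act i (code_act (Suc i) (code_act i c))"
    have asc: "c i \<le> c (Suc i)" "c (Suc i) \<le> c (Suc (Suc i))" using i j True by auto
    have z: "?z = code_act (Suc i) (code_act i (code_act (Suc i) c))" by (rule code_act_braid[OF asc])
    \<comment> \<open>\<open>h\<close> belongs to the common upper bound. Descending from it along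
      both sides of the braid relation reaches both covers of \<open>c\<close>, where the induction
      hypothesis identifies the results with \<open>f'\<close> and \<open>g'\<close>.\<close>
    obtain h where h: "is_schubert n ?z h"
      using is_schubert_exists is_code_act code i(1) j(1) True by metis
    have "is_schubert n (code_act (Suc i) (code_act i c)) (div_diff i h)"
      using is_schubert_act[OF h i(1)] asc
      by (simp add: code_act_def[of i c] code_act_def[of "Suc i"])
    then have "is_schubert n (code_act i c) (div_diff (Suc i) (div_diff i h))"
      using is_schubert_act[of n "Suc i" "code_act i c"] j(1) True asc
      by (simp add: code_act_def[of i c])
    then have f': "f' = div_diff (Suc i) (div_diff i h)" using IH i by blast
    have "is_schubert n (code_act i (code_act (Suc i) c)) (div_diff (Suc i) h)"
      using is_schubert_act[of n "Suc i" _ h] h z j(1) True asc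
      by (simp add: code_act_def[of "Suc i" c] code_act_def[of i])
    then have "is_schubert n (code_act (Suc i) c) (div_diff i (div_diff (Suc i) h))"
      using is_schubert_act[of n i "code_act (Suc i) c"] i(1) asc
      by (simp add: code_act_def[of "Suc i" c])
    then have g': "g' = div_diff i (div_diff (Suc i) h)" using IH j True by blast
    show ?thesis using f' g' div_diff_braid True by simp
  next
    case False
    then have ij: "Suc i < j" using \<open>i < j\<close> by simp
    obtain h where h: "is_schubert n (code_act i (code_act j c)) h"
      using is_schubert_exists is_code_act code i(1) j(1) by metis
    have "is_schubert n (code_act j c) (div_diff i h)"
      using is_schubert_act[OF h i(1)] i(2) ij by (simp add: code_act_def[of j c])
    then have g': "g' = div_diff i h" using IH j by blast
    have "is_schubert n (code_act i c) (div_diff j h)"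
      using is_schubert_act[of n j "code_act i c" h] h j ij code_act_commute[OF ij, of c]
      by (simp add: code_act_def[of i c])
    then have "f' = div_diff j h" using IH i by blast
    then show ?thesis using g' div_diff_commute[OF ij] by simp
  qed
  from less.prems(1) show ?case
  proof (cases rule: is_schubert_cases)
    case 1
    from less.prems(2) show ?thesis
      using 1 top by (cases rule: is_schubert_cases) auto
  next
    case (2 i f')
    note i = this
    from less.prems(2) show ?thesis
    proof (cases rule: is_schubert_cases)
      case 1
      then show ?thesis using i top by auto
    next
      case (2 j g')
      then show ?thesis
        using i diamond[of i j f' g'] diamond[of j i g' f'] IH[of i f' g']
        by (metis linorder_neqE_nat)
    qed
  qed
qed

text \<open>By uniqueness \<open>f\<close> is itself a divided difference at \<open>i\<close>, and
  the square of \<open>div_diff i\<close> is zero. Hence \<open>f\<close> is symmetric in the two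
  variables.\<close>

lemma is_schubert_ascent:
  assumes "is_schubert n c f" "i \<in> {1..<n}" "c i \<le> c (Suc i)"
  shows "div_diff i f = 0"
proof -
  obtain g where "is_schubert n (code_act i c) g"
    using is_schubert_exists is_code_act is_schubert_is_code assms by metis
  then show ?thesis
    using is_schubert_unique[OF assms(1) is_schubert_act] assms(2,3) div_diff_div_diff by metis
qed

section \<open>Leading monomials\<close>

lemma coeff_div_diff_mult:
  "(if expo U i = 0 then 0 else coeff (div_diff i f) (U - var_pow i 1)) -
   (if expo U (Suc i) = 0 then 0 else coeff (div_diff i f) (U - var_pow (Suc i) 1)) =
   coeff f U - coeff f (swap_mon i U)"
  using arg_cong[OF div_diff_mult[of i f], of "\<lambda>g. coeff g U"]
  by (simp add: left_diff_distrib lookup_minus lookup_var_mult lookup_swap_poly)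

text \<open>Coefficients are compared at \<open>M + var_pow (Suc i) (Suc b)\<close>. This monomial
  is free of the \<open>i\<close>-th variable, so only the factor \<open>var (Suc i)\<close>
  contributes on the left.\<close>

lemma coeff_div_diff:
  assumes "expo M i = 0" "expo M (Suc i) = 0"
  shows "coeff (div_diff i f) (M + var_pow (Suc i) b) =
    coeff f (M + var_pow i (Suc b)) - coeff f (M + var_pow (Suc i) (Suc b))"
proof -
  have "M + var_pow (Suc i) (Suc b) - var_pow (Suc i) 1 = M + var_pow (Suc i) b"
    by (intro poly_mapping_eqI) (auto simp: lookup_add lookup_minus lookup_single when_def)
  moreover have "swap_mon i (M + var_pow (Suc i) (Suc b)) = M + var_pow i (Suc b)"
    using assms
    by (intro poly_mapping_eqI)
      (auto simp: lookup_swap_mon lookup_add lookup_single when_def transpose_def)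
  ultimately show ?thesis
    using coeff_div_diff_mult[of "M + var_pow (Suc i) (Suc b)" i f] assms
    by (simp add: lookup_add lookup_single)
qed

text \<open>Traces a monomial of the quotient back to one of \<open>f\<close>, which bounds
  exponents without an explicit formula for the quotient.\<close>

lemma keys_div_diff:
  assumes "U \<in> Poly_Mapping.keys (div_diff i f)"
  obtains V where "V \<in> Poly_Mapping.keys f" "\<And>j. j \<noteq> i \<Longrightarrow> j \<noteq> Suc i \<Longrightarrow> expo V j = expo U j"
    "expo V i + expo V (Suc i) = Suc (expo U i + expo U (Suc i))"
    "expo U i < max (expo V i) (expo V (Suc i))"
proof -
  let ?g = "div_diff i f"
  let ?P = "\<lambda>V. V \<in> Poly_Mapping.keys ?g \<and> (\<forall>j. j \<noteq> i \<longrightarrow> j \<noteq> Suc i \<longrightarrow> expo V j = expo U j) \<and>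
    expo V i + expo V (Suc i) = expo U i + expo U (Suc i) \<and> expo U i \<le> expo V i"
  \<comment> \<open>Take \<open>V\<close> with maximal exponent at \<open>i\<close>, so that \<open>x\<^sub>iV\<close> cannot cancel in the product.\<close>
  define S where "S = {V. ?P V}"
  have fin: "finite S" unfolding S_def by (rule finite_subset[of _ "Poly_Mapping.keys ?g"]) auto
  have "U \<in> S" using assms by (simp add: S_def)
  then have "S \<noteq> {}" by blast
  then obtain V where "V \<in> S" and Max: "expo V i = Max ((\<lambda>V. expo V i) ` S)"
    using obtains_MAX[OF fin, of "\<lambda>V. expo V i"] by metis
  have max: "expo V' i \<le> expo V i" if "?P V'" for V'
    unfolding Max by (rule Max_ge) (use fin that in \<open>auto simp: S_def\<close>)
  have V: "?P V" using \<open>V \<in> S\<close> by (simp add: S_def)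
  define T where "T = V + var_pow i 1"
  have T: "expo T j = (if j = i then Suc (expo V i) else expo V j)" for j
    by (simp add: T_def lookup_add lookup_single when_def)
  \<comment> \<open>The only term that could cancel \<open>T\<close> in the product would have
    exponent \<open>expo V i + 1\<close> at \<open>i\<close>, against maximality.\<close>
  have "coeff ?g (T - var_pow (Suc i) 1) = 0" if "expo V (Suc i) \<noteq> 0"
  proof (rule ccontr)
    assume "coeff ?g (T - var_pow (Suc i) 1) \<noteq> 0"
    then have "?P (T - var_pow (Suc i) 1)"
      using V that by (auto simp: in_keys_iff lookup_minus T lookup_single when_def)
    then have "expo (T - var_pow (Suc i) 1) i \<le> expo V i" by (rule max)
    then show False by (simp add: lookup_minus T lookup_single)
  qed
  moreover have "T - var_pow i 1 = V" by (simp add: T_def)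
  moreover have "coeff ?g V \<noteq> 0" using V by (simp add: in_keys_iff)
  ultimately have "coeff f T - coeff f (swap_mon i T) \<noteq> 0"
    using coeff_div_diff_mult[of T i f] T[of i] T[of "Suc i"] by (auto split: if_splits)
  then have "coeff f T \<noteq> 0 \<or> coeff f (swap_mon i T) \<noteq> 0" by auto
  then show ?thesis
  proof
    assume "coeff f T \<noteq> 0"
    then show ?thesis using V T by (intro that[of T]) (auto simp: in_keys_iff)
  next
    assume "coeff f (swap_mon i T) \<noteq> 0"
    then show ?thesis using V
      by (intro that[of "swap_mon i T"]) (auto simp: in_keys_iff lookup_swap_mon T transpose_def)
  qed
qed

lemma keys_div_diff_swap:
  "U \<in> Poly_Mapping.keys (div_diff i f) \<Longrightarrow> swap_mon i U \<in> Poly_Mapping.keys (div_diff i f)"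
  by (metis in_keys_iff lookup_swap_poly swap_div_diff)

lemma prod_single:
  "finite A \<Longrightarrow> (\<Prod>i\<in>A. Poly_Mapping.single (m i) (1::int)) = Poly_Mapping.single (\<Sum>i\<in>A. m i) 1"
  by (induction A rule: finite_induct) (simp_all add: mult_single)

lemma lookup_sum_var_pow:
  "finite A \<Longrightarrow> expo (\<Sum>l\<in>A. var_pow l (g l)) j = (if j \<in> A then g j else 0)"
  by (auto simp: lookup_sum lookup_single when_def sum.delta)

lemma schubert_w0_monomial:
  obtains U where "schubert_w0 n = Poly_Mapping.single U 1" "expo U = staircase n"
proof
  show "schubert_w0 n = Poly_Mapping.single (\<Sum>i\<in>{1..n - 1}. var_pow i (n - i)) 1"
    unfolding schubert_w0_def by (simp add: prod_single flip: single_var_pow)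
  show "expo (\<Sum>i\<in>{1..n - 1}. var_pow i (n - i)) = staircase n"
    by (rule ext) (auto simp: lookup_sum_var_pow staircase_def)
qed

text \<open>Divided differences preserve homogeneity and lower the degree by one; the strict bound
  in \<open>keys_div_diff\<close> keeps the exponents below the staircase.\<close>

lemma is_schubert_keys:
  assumes "is_schubert n c f" "U \<in> Poly_Mapping.keys f"
  shows "is_code n (expo U)" "code_sum n (expo U) = code_sum n c"
proof -
  have "is_code n (expo U) \<and> code_sum n (expo U) = code_sum n c"
    using assms
  proof (induction arbitrary: U rule: is_schubert.induct)
    case top
    then show ?case
      using schubert_w0_monomial[of n] is_code_staircase
      by (metis keys_single singletonD zero_neq_one)
  next
    case (descent c f i)
    obtain V where V: "V \<in> Poly_Mapping.keys f" "\<And>j. j \<noteq> i \<Longrightarrow> j \<noteq> Suc i \<Longrightarrow> expo V j = expo U j"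
      "expo V i + expo V (Suc i) = Suc (expo U i + expo U (Suc i))"
      "expo U i < max (expo V i) (expo V (Suc i))"
      using keys_div_diff[OF descent.prems] by blast
    \<comment> \<open>The quotient is symmetric, so the swapped monomial yields the same strict
      bound for the exponent at \<open>Suc i\<close>. Strictness accounts for the drop from
      \<open>n - i\<close> to \<open>n - Suc i\<close>.\<close>
    obtain V' where V': "V' \<in> Poly_Mapping.keys f"
      "expo U (Suc i) < max (expo V' i) (expo V' (Suc i))"
      using keys_div_diff[OF keys_div_diff_swap[OF descent.prems]]
      by (auto simp: lookup_swap_mon)
    have bound: "expo V j \<le> staircase n j" "expo V' j \<le> staircase n j" for j
      using descent.IH V(1) V'(1) by (auto simp: is_code_def)
    have "expo U j \<le> staircase n j" for j
      using bound[of i] bound[of "Suc i"] bound[of j] V V' descent.hyps(2)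
      by (cases "j = i"; cases "j = Suc i") (auto simp: staircase_def max_def split: if_splits)
    moreover have "code_sum n (expo V) = Suc (code_sum n (expo U))"
    proof -
      have split: "code_sum n d = d i + d (Suc i) + (\<Sum>j\<in>{1..n} - {i, Suc i}. d j)" for d
        using descent.hyps(2) sum.subset_diff[of "{i, Suc i}" "{1..n}" d]
        by (simp add: code_sum_def)
      have "(\<Sum>j\<in>{1..n} - {i, Suc i}. expo V j) = (\<Sum>j\<in>{1..n} - {i, Suc i}. expo U j)"
        by (intro sum.cong) (auto simp: V(2))
      then show ?thesis using split[of "expo V"] split[of "expo U"] V(3) by simp
    qed
    ultimately show ?case
      using descent.IH[OF V(1)] code_sum_act(1)[OF descent.hyps(2), of c] descent.hyps(3)
      by (simp add: is_code_def)
  qed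
  then show "is_code n (expo U)" "code_sum n (expo U) = code_sum n c" by auto
qed

lemma is_schubert_no_vars:
  assumes "is_schubert n c f"
    and "\<And>j. m < j \<Longrightarrow> c j = 0" "U \<in> Poly_Mapping.keys f" "m < j"
  shows "expo U j = 0"
proof (cases "j \<le> n")
  case False
  then show ?thesis
    using is_schubert_keys(1)[OF assms(1,3)] by (auto simp: is_code_def staircase_def dest: spec[of _ j])
next
  case True
  \<comment> \<open>\<open>f\<close> is symmetric in \<open>x\<^sub>m\<^sub>+\<^sub>1, \<dots>, x\<^sub>n\<close> and free of \<open>x\<^sub>n\<close>.\<close>
  have "\<forall>U\<in>Poly_Mapping.keys f. expo U j = 0"
    using True assms(4)
  proof (induction j rule: inc_induct)
    case base
    show ?case
    proof
      fix U assume "U \<in> Poly_Mapping.keys f"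
      then have "expo U n \<le> staircase n n"
        using is_schubert_keys(1)[OF assms(1)] unfolding is_code_def by blast
      then show "expo U n = 0" by (simp add: staircase_def split: if_splits)
    qed
  next
    case (step k)
    have "div_diff k f = 0"
      using is_schubert_ascent[OF assms(1), of k] assms(2) step by auto
    then have "swap_mon k U \<in> Poly_Mapping.keys f" if "U \<in> Poly_Mapping.keys f" for U
      using that by (metis div_diff_eq_0_iff in_keys_iff lookup_swap_poly)
    then show ?case using step by (metis less_SucI lookup_swap_mon transpose_apply_second)
  qed
  then show ?thesis using assms(3) by blast
qed

section \<open>Chains of descents and the leading monomial\<close>

abbreviation shift_code :: "nat \<Rightarrow> nat \<Rightarrow> (nat \<Rightarrow> nat) \<Rightarrow> nat \<Rightarrow> nat"
  where "shift_code t r c \<equiv>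
    \<lambda>j. if t \<le> j \<and> j < r then c (Suc j) else if j = r then c t - (r - t) else c j"

text \<open>The entry at \<open>t\<close> travels right, losing one per step, while the entries it
  passes slide left. At place \<open>r\<close> it is \<open>c t - (r - t)\<close>, and the height
  condition says exactly that this exceeds the next entry \<open>c (Suc r)\<close>.\<close>

lemma is_schubert_shift:
  assumes "is_schubert n c f" "1 \<le> t" "t \<le> r" "r \<le> n"
    and "\<And>j. t < j \<Longrightarrow> j \<le> r \<Longrightarrow> c j + j \<le> c t + t"
  shows "is_schubert n (shift_code t r c)
    (foldr div_diff (rev [t..<r]) f)"
  using assms(3,4,5)
proof (induction r rule: dec_induct)
  case base
  have "shift_code t t c = c"
    by auto
  then show ?case using assms(1) by simp
next
  case (step r)
  let ?d = "\<lambda>r. shift_code t r c"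
  have "c (Suc r) + Suc r \<le> c t + t" using step.hyps(1) by (intro step.prems(2)) auto
  then have "?d r (Suc r) < ?d r r" and code_act: "code_act r (?d r) = ?d (Suc r)"
    using step.hyps by (auto simp: code_act_def fun_eq_iff)
  then have "is_schubert n (code_act r (?d r)) (div_diff r (foldr div_diff (rev [t..<r]) f))"
    using step assms(2) by (intro is_schubert.descent) auto
  then show ?case using step.hyps unfolding code_act by simp
qed

text \<open>After each step the code vanishes beyond the travelling entry, so the later variables
  are absent. The second term of \<open>coeff_div_diff\<close> then drops out, and each step trades
  one power of the current variable for a move to the next variable.\<close>

lemma is_schubert_coeff_shift:
  assumes "is_schubert n c f" "1 \<le> m"
    and "\<And>j. m < j \<Longrightarrow> c j = 0" "q \<le> c m" "m + q \<le> n"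
    and M: "\<And>j. m \<le> j \<Longrightarrow> expo M j = 0"
  shows "coeff (foldr div_diff (rev [m..<m + q]) f) (M + var_pow (m + q) b) =
    coeff f (M + var_pow m (q + b))"
  using assms(4,5)
proof (induction q arbitrary: b)
  case (Suc q)
  let ?F = "foldr div_diff (rev [m..<m + q]) f"
  have F: "is_schubert n (shift_code m (m + q) c) ?F"
    using Suc.prems assms(3) by (intro is_schubert_shift assms) auto
  have "coeff ?F (M + var_pow (Suc (m + q)) (Suc b)) = 0"
  proof (rule ccontr)
    assume "coeff ?F (M + var_pow (Suc (m + q)) (Suc b)) \<noteq> 0"
    then show False
      using is_schubert_no_vars[OF F, of "m + q" "M + var_pow (Suc (m + q)) (Suc b)" "Suc (m + q)"] assms(3)
      by (auto simp: in_keys_iff lookup_add)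
  qed
  then have "coeff (div_diff (m + q) ?F) (M + var_pow (Suc (m + q)) b) = coeff ?F (M + var_pow (m + q) (Suc b))"
    using M by (simp add: coeff_div_diff)
  then show ?case using Suc by simp
qed simp

text \<open>The tie-break of the monomial order among monomials of equal degree: the highest
  differing index decides.\<close>

definition lex_less :: "(nat \<Rightarrow> nat) \<Rightarrow> (nat \<Rightarrow> nat) \<Rightarrow> bool"
  where "lex_less u c \<longleftrightarrow> (\<exists>r. u r < c r \<and> (\<forall>j>r. u j = c j))"

text \<open>The leading coefficient is carried along as the constant term of \<open>f0\<close>, the
  polynomial of the zero code, and is evaluated only later.\<close>

lemma is_schubert_leading_aux:
  assumes "is_schubert n (\<lambda>_. 0) f0" "is_schubert n c f"
    and "\<And>j. m < j \<Longrightarrow> c j = 0" "m < n"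
  shows "(\<forall>U\<in>Poly_Mapping.keys f. expo U = c \<or> lex_less (expo U) c) \<and>
    (\<forall>U. expo U = c \<longrightarrow> coeff f U = coeff f0 0)"
  using assms(2-4)
proof (induction m arbitrary: c f)
  case 0
  have "c j = 0" for j
    using 0(2)[of j] is_schubert_is_code[OF 0(1)]
    by (cases j) (auto simp: is_code_def staircase_def dest: spec[of _ 0])
  then have c: "c = (\<lambda>_. 0)" by auto
  then have f: "f = f0" using is_schubert_unique 0(1) assms(1) by blast
  have "expo U j = 0" if "U \<in> Poly_Mapping.keys f" for U j
    using is_schubert_no_vars[OF 0(1), of 0 U j] 0(2) that is_schubert_keys(1)[OF 0(1) that] unfolding is_code_def
    by (cases "j = 0") (auto simp: staircase_def dest: spec[of _ 0])
  moreover have "U = 0" if "expo U = c" for U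
    using that c by (intro poly_mapping_eqI) simp
  ultimately show ?case using c f by auto
next
  case (Suc m')
  let ?m = "Suc m'"
  let ?p = "c ?m"
  define F where "F = foldr div_diff (rev [?m..<?m + ?p]) f"
  let ?d = "c(?m := 0)"
  have p: "?m + ?p \<le> n"
    using is_schubert_is_code[OF Suc.prems(1)] Suc.prems(3)
    by (auto simp: is_code_def staircase_def dest: spec[of _ ?m])
  have "is_schubert n (shift_code ?m (?m + ?p) c) F"
    unfolding F_def using p Suc.prems(2) by (intro is_schubert_shift Suc.prems(1)) auto
  \<comment> \<open>The travelling entry has used up its value \<open>?p\<close>, and all entries it
    passed are zero.\<close>
  moreover have "shift_code ?m (?m + ?p) c = ?d"
    using Suc.prems(2) by (auto simp: fun_eq_iff)
  ultimately have schF: "is_schubert n ?d F" by simp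
  have d0: "?d j = 0" if "m' < j" for j using that Suc.prems(2) by auto
  have IH: "(\<forall>U\<in>Poly_Mapping.keys F. expo U = ?d \<or> lex_less (expo U) ?d) \<and>
    (\<forall>U. expo U = ?d \<longrightarrow> coeff F U = coeff f0 0)"
    by (rule Suc.IH[OF schF]) (erule d0, rule Suc_lessD[OF Suc.prems(3)])
  have shift: "coeff F (M + var_pow (?m + ?p) b) = coeff f (M + var_pow ?m (?p + b))"
    if "\<And>j. ?m \<le> j \<Longrightarrow> expo M j = 0" for M b
    unfolding F_def using p that by (intro is_schubert_coeff_shift[OF Suc.prems(1)] Suc.prems(2)) auto
  have split: "(U - var_pow ?m (expo U ?m)) + var_pow ?m (expo U ?m) = U" for U
    by (intro poly_mapping_eqI) (auto simp: lookup_add lookup_minus lookup_single when_def)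
  have expo_rest: "expo (U - var_pow ?m (expo U ?m)) = (expo U)(?m := 0)" for U
    by (auto simp: lookup_minus lookup_single when_def)
  show ?case
  proof (intro conjI allI impI ballI)
    fix U assume U: "expo U = c"
    let ?M = "U - var_pow ?m ?p"
    have M: "expo ?M = ?d" using expo_rest[of U] U by simp
    then have "coeff F ?M = coeff f U"
      using shift[of ?M 0] split[of U] U d0 by simp
    then show "coeff f U = coeff f0 0" using IH M by auto
  next
    fix U assume U: "U \<in> Poly_Mapping.keys f"
    have U0: "expo U j = 0" if "?m < j" for j
      using is_schubert_no_vars[OF Suc.prems(1)] Suc.prems(2) U that by blast
    let ?a = "expo U ?m"
    let ?M = "U - var_pow ?m ?a"
    have M: "expo ?M = (expo U)(?m := 0)" by (rule expo_rest)
    have M0: "expo ?M j = 0" if "?m \<le> j" for j using that U0 by (simp add: M)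
    consider "?a < ?p" | "?a = ?p" | "?p < ?a" by linarith
    then show "expo U = c \<or> lex_less (expo U) c"
    proof cases
      case 1
      then have "lex_less (expo U) c"
        using U0 Suc.prems(2) unfolding lex_less_def by (intro exI[of _ ?m]) auto
      then show ?thesis ..
    next
      case 2
      then have "coeff F ?M = coeff f U"
        using shift[of ?M 0] M0 split[of U] by simp
      then have "expo ?M = ?d \<or> lex_less (expo ?M) ?d"
        using IH U by (simp add: in_keys_iff)
      then show ?thesis
      proof
        assume "expo ?M = ?d"
        then have "expo U = c"
          using 2 M by (metis fun_upd_triv fun_upd_upd)
        then show ?thesis ..
      next
        assume "lex_less (expo ?M) ?d"
        then obtain r where r: "expo ?M r < ?d r" "\<And>j. r < j \<Longrightarrow> expo ?M j = ?d j"
          unfolding lex_less_def by blast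
        have "r \<noteq> ?m" using r(1) by auto
        moreover have "expo U j = c j" if "r < j" for j
          using r(2)[OF that] 2 M by (cases "j = ?m") auto
        ultimately have "lex_less (expo U) c"
          using r(1) M unfolding lex_less_def by (intro exI[of _ r]) auto
        then show ?thesis ..
      qed
    next
      case 3
      \<comment> \<open>This bound and \<open>?p < ?a\<close> give \<open>?m + ?p < n\<close>, so
        one more divided difference is available. It meets two zero entries and kills
        \<open>F\<close>, hence also the coefficients of powers above \<open>?p\<close>.\<close>
      have "expo U ?m \<le> n - ?m"
        using is_schubert_keys(1)[OF Suc.prems(1) U]
        by (auto simp: is_code_def staircase_def dest: spec[of _ ?m])
      then have "div_diff (?m + ?p) F = 0"
        using 3 Suc.prems(2) by (intro is_schubert_ascent[OF schF]) auto
      moreover have "coeff F (M' + var_pow (Suc (?m + ?p)) (Suc b)) = 0" for M' b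
      proof (rule ccontr)
        assume "coeff F (M' + var_pow (Suc (?m + ?p)) (Suc b)) \<noteq> 0"
        then show False
          using is_schubert_no_vars[OF schF d0, of m' "M' + var_pow (Suc (?m + ?p)) (Suc b)" "Suc (?m + ?p)"]
          by (auto simp: in_keys_iff lookup_add)
      qed
      moreover have b: "Suc (?a - ?p - 1) = ?a - ?p" using 3 by simp
      ultimately have "coeff F (?M + var_pow (?m + ?p) (?a - ?p)) = 0"
        using coeff_div_diff[of ?M "?m + ?p" F "?a - ?p - 1"] M0
        by (metis le_add1 le_SucI diff_0_right lookup_zero)
      then have "coeff f U = 0"
        using shift[OF M0, of "?a - ?p"] 3 split[of U] by simp
      then show ?thesis using U by (simp add: in_keys_iff)
    qed
  qed
qed

lemma is_schubert_leading:
  assumes "is_schubert n c f" "n \<ge> 1"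
  shows "U \<in> Poly_Mapping.keys f \<Longrightarrow> expo U = c \<or> lex_less (expo U) c"
    and "expo U = c \<Longrightarrow> coeff f U = 1"
proof -
  have "is_code n (\<lambda>_. 0)" by (simp add: is_code_def)
  then obtain f0 where f0: "is_schubert n (\<lambda>_. 0) f0" using is_schubert_exists by blast
  have zero: "c j = 0" if "is_schubert n c f" "n - 1 < j" for c f j
    using that is_schubert_is_code[OF that(1)]
    by (auto simp: is_code_def staircase_def dest: spec[of _ j])
  have lead: "(\<forall>U\<in>Poly_Mapping.keys f. expo U = c \<or> lex_less (expo U) c) \<and>
    (\<forall>U. expo U = c \<longrightarrow> coeff f U = coeff f0 0)" if "is_schubert n c f" for c f
    using is_schubert_leading_aux[OF f0 that, of "n - 1"] zero[OF that] assms(2) by simp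
  obtain V where "schubert_w0 n = Poly_Mapping.single V 1" "expo V = staircase n"
    by (rule schubert_w0_monomial)
  \<comment> \<open>The common leading coefficient is read off at the staircase monomial.\<close>
  then have "coeff f0 0 = 1" using lead[OF is_schubert.top] by (metis lookup_single_eq)
  then show "U \<in> Poly_Mapping.keys f \<Longrightarrow> expo U = c \<or> lex_less (expo U) c"
    and "expo U = c \<Longrightarrow> coeff f U = 1"
    using lead[OF assms(1)] by auto
qed

lemma code_sum_eq: "is_code n c \<Longrightarrow> code_sum n c = (\<Sum>i\<in>{1..n - 1}. c i)"
  by (cases n) (auto simp: code_sum_def is_code_def staircase_def dest: spec[of _ n])

text \<open>Equal degrees tie the first component of the tuples. The deciding index lies in
  \<open>{1..<n}\<close> because a code is positive only there, and the reversed lists agree up to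
  it.\<close>

lemma mon_less_lex:
  assumes "is_code n (expo U)" "is_code n (expo V)" "code_sum n (expo U) = code_sum n (expo V)"
    and "lex_less (expo U) (expo V)"
  shows "mon_less n U V"
proof -
  obtain r where r: "expo U r < expo V r" "\<And>j. r < j \<Longrightarrow> expo U j = expo V j"
    using assms(4) unfolding lex_less_def by blast
  have "0 < staircase n r"
    using assms(2) r(1) unfolding is_code_def by (metis gr0I le_zero_eq not_less_zero)
  then have "1 \<le> r" "r < n" by (auto simp: staircase_def split: if_splits)
  then have "[1..<n] = [1..<r] @ r # [Suc r..<n]"
    by (metis le_add_diff_inverse less_imp_le upt_add_eq_append upt_conv_Cons)
  then have tuple: "rev (map g [1..<n]) = rev (map g [Suc r..<n]) @ g r # rev (map g [1..<r])" for g :: "nat \<Rightarrow> nat"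
    by simp
  have "map (expo U) [Suc r..<n] = map (expo V) [Suc r..<n]"
    using r(2) by auto
  then have "(rev (map (expo U) [1..<n]), rev (map (expo V) [1..<n])) \<in> lexord {(a, b). a < b}"
    unfolding tuple using r(1) by (simp only:) (rule lexord_append_leftI, simp)
  then show ?thesis
    using assms by (simp add: mon_less_def mon_tuple_def code_sum_eq)
qed

lemma is_schubert_has_leading_mon:
  assumes "is_schubert n (expo W) f" "n \<ge> 1"
  shows "has_leading_mon n f W"
  unfolding has_leading_mon_def
proof (intro conjI ballI impI)
  show "W \<in> Poly_Mapping.keys f"
    using is_schubert_leading(2)[OF assms, of W] by (simp add: in_keys_iff)
next
  fix V assume V: "V \<in> Poly_Mapping.keys f" "V \<noteq> W"
  then have "lex_less (expo V) (expo W)"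
    using is_schubert_leading(1)[OF assms V(1)] poly_mapping_eq_iff[of V W] by blast
  then show "mon_less n V W"
    using is_schubert_keys[OF assms(1) V(1)] is_schubert_is_code[OF assms(1)]
    by (intro mon_less_lex) auto
qed

section \<open>Permutations and their codes\<close>

lemma B_x_iff: "W \<in> B_x n \<longleftrightarrow> is_code n (expo W)"
proof
  assume W: "W \<in> B_x n"
  have "expo W j \<le> staircase n j" for j
  proof (cases "j \<in> {1..n - 1}")
    case True
    then have "expo W j + j \<le> n" using W by (auto simp: B_x_def)
    then show ?thesis using True by (simp add: staircase_def)
  next
    case False
    then have "expo W j = 0" using W by (auto simp: B_x_def in_keys_iff)
    then show ?thesis by simp
  qed
  then show "is_code n (expo W)" by (simp add: is_code_def)
next
  assume "is_code n (expo W)"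
  then have le: "expo W j \<le> staircase n j" for j by (simp add: is_code_def)
  have "j \<in> {1..n - 1}" if "expo W j \<noteq> 0" for j
    using le[of j] that by (auto simp: staircase_def split: if_splits)
  moreover have "expo W j + j \<le> n" if "j \<in> {1..n - 1}" for j
    using le[of j] that by (auto simp: staircase_def)
  ultimately show "W \<in> B_x n" by (auto simp: B_x_def in_keys_iff)
qed

definition perm_code :: "nat \<Rightarrow> (nat \<Rightarrow> nat) \<Rightarrow> nat \<Rightarrow> nat"
  where "perm_code n \<pi> i = (if i \<in> {1..n} then card {j \<in> {i<..n}. \<pi> j < \<pi> i} else 0)"

text \<open>The longest element of the symmetric group, extended by fixed points as
  \<open>permutes\<close> requires.\<close>

definition rev_perm :: "nat \<Rightarrow> nat \<Rightarrow> nat"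
  where "rev_perm n j = (if j \<in> {1..n} then n + 1 - j else j)"

lemma is_code_perm_code: "is_code n (perm_code n \<pi>)"
proof -
  have "card {j \<in> {i<..n}. \<pi> j < \<pi> i} \<le> card {i<..n}" for i
    by (intro card_mono) auto
  then show ?thesis by (auto simp: is_code_def perm_code_def staircase_def)
qed

text \<open>Entries left of \<open>i\<close> count over sets that the transposition only permutes.
  At \<open>i\<close> and \<open>Suc i\<close> the counts over later positions change places, and
  the comparison of the two values themselves adds one to the first entry exactly when they are
  inverted.\<close>

lemma perm_code_transpose:
  assumes "\<pi> permutes {1..n}" "i \<in> {1..<n}"
  shows "perm_code n (\<pi> \<circ> transpose i (Suc i)) = code_act i (perm_code n \<pi>)"
proof
  fix l
  let ?\<tau> = "transpose i (Suc i)"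
  let ?A = "{j \<in> {Suc i<..n}. \<pi> j < \<pi> i}" and ?B = "{j \<in> {Suc i<..n}. \<pi> j < \<pi> (Suc i)}"
  have neq: "\<pi> i \<noteq> \<pi> (Suc i)"
    using permutes_inj[OF assms(1)] by (metis injD n_not_Suc_n)
  have first: "card {j \<in> {i<..n}. \<sigma> j < x} = card {j \<in> {Suc i<..n}. \<sigma> j < x} + (if \<sigma> (Suc i) < x then 1 else 0)"
    for \<sigma> :: "nat \<Rightarrow> nat" and x
  proof -
    have "{j \<in> {i<..n}. \<sigma> j < x} = (if \<sigma> (Suc i) < x then insert (Suc i) {j \<in> {Suc i<..n}. \<sigma> j < x}
        else {j \<in> {Suc i<..n}. \<sigma> j < x})"
      using assms(2) by (auto simp: Suc_le_eq le_less) (metis Suc_lessI)+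
    then show ?thesis by simp
  qed
  have i: "perm_code n \<pi> i = card ?A + (if \<pi> (Suc i) < \<pi> i then 1 else 0)"
    using assms(2) first[of \<pi> "\<pi> i"] by (simp add: perm_code_def)
  have Si: "perm_code n \<pi> (Suc i) = card ?B"
    using assms(2) by (simp add: perm_code_def)
  have above: "{j \<in> {Suc i<..n}. (\<pi> \<circ> ?\<tau>) j < x} = {j \<in> {Suc i<..n}. \<pi> j < x}" for x
    by (auto simp: transpose_def)
  have i': "perm_code n (\<pi> \<circ> ?\<tau>) i = card ?B + (if \<pi> i < \<pi> (Suc i) then 1 else 0)"
    using assms(2) first[of "\<pi> \<circ> ?\<tau>" "\<pi> (Suc i)"] above
    by (simp add: perm_code_def)
  have Si': "perm_code n (\<pi> \<circ> ?\<tau>) (Suc i) = card ?A"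
    using assms(2) above by (simp add: perm_code_def)
  \<comment> \<open>These inclusions turn the comparison of the two values into the comparison of
    entries tested by \<open>code_act\<close>.\<close>
  have BA: "card ?B \<le> card ?A" if "\<pi> (Suc i) < \<pi> i"
    using that by (intro card_mono) auto
  have AB: "card ?A \<le> card ?B" if "\<pi> i < \<pi> (Suc i)"
    using that by (intro card_mono) auto
  have other: "perm_code n (\<pi> \<circ> ?\<tau>) l = perm_code n \<pi> l" if l: "l \<noteq> i" "l \<noteq> Suc i"
  proof (cases "l < i")
    case True
    have "{j \<in> {l<..n}. (\<pi> \<circ> ?\<tau>) j < \<pi> l} = ?\<tau> ` {j \<in> {l<..n}. \<pi> j < \<pi> l}"
    proof (intro set_eqI iffI)
      fix j assume "j \<in> {j \<in> {l<..n}. (\<pi> \<circ> ?\<tau>) j < \<pi> l}"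
      then show "j \<in> ?\<tau> ` {j \<in> {l<..n}. \<pi> j < \<pi> l}"
        using True assms(2) by (intro image_eqI[of _ _ "?\<tau> j"]) (auto simp: transpose_def)
    qed (use True assms(2) in \<open>auto simp: transpose_def\<close>)
    then have "card {j \<in> {l<..n}. (\<pi> \<circ> ?\<tau>) j < \<pi> l} = card {j \<in> {l<..n}. \<pi> j < \<pi> l}"
      by (simp add: card_image inj_on_subset)
    then show ?thesis using l by (simp add: perm_code_def)
  next
    case False
    then have "{j \<in> {l<..n}. (\<pi> \<circ> ?\<tau>) j < \<pi> l} = {j \<in> {l<..n}. \<pi> j < \<pi> l}"
      using l by (auto simp: transpose_def)
    then show ?thesis using l by (simp add: perm_code_def)
  qed
  show "perm_code n (\<pi> \<circ> ?\<tau>) l = code_act i (perm_code n \<pi>) l"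
    using neq i Si i' Si' BA AB other by (auto simp: code_act_def)
qed

lemma rev_perm_permutes: "rev_perm n permutes {1..n}"
proof -
  have "rev_perm n (rev_perm n j) = j" for j by (auto simp: rev_perm_def)
  then show ?thesis unfolding permutes_def by (metis rev_perm_def)
qed

lemma perm_code_rev_perm: "perm_code n (rev_perm n) = staircase n"
proof
  fix i
  have "{j \<in> {i<..n}. rev_perm n j < rev_perm n i} = {i<..n}" if "i \<in> {1..n}"
    using that by (auto simp: rev_perm_def)
  then show "perm_code n (rev_perm n) i = staircase n i"
    by (auto simp: perm_code_def staircase_def)
qed

text \<open>Maximal entries mean that all later values are smaller. The values below
  \<open>\<pi> i\<close> are then exactly those at later positions, and counting them determines
  \<open>\<pi> i\<close>.\<close>

lemma perm_code_eq_staircase: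
  assumes "\<pi> permutes {1..n}" "perm_code n \<pi> = staircase n"
  shows "\<pi> = rev_perm n"
proof
  fix i
  show "\<pi> i = rev_perm n i"
  proof (cases "i \<in> {1..n}")
    case False
    then show ?thesis using permutes_not_in[OF assms(1)] by (auto simp: rev_perm_def)
  next
    case True
    have less: "\<pi> k < \<pi> j" if "j \<in> {1..n}" "j < k" "k \<le> n" for j k
    proof -
      have "card {k \<in> {j<..n}. \<pi> k < \<pi> j} = card {j<..n}"
        using fun_cong[OF assms(2), of j] that(1) by (simp add: perm_code_def staircase_def)
      then have "{k \<in> {j<..n}. \<pi> k < \<pi> j} = {j<..n}"
        by (intro card_subset_eq) auto
      moreover have "k \<in> {j<..n}" using that by simp
      ultimately show ?thesis by blast
    qed
    have "{1..<\<pi> i} = \<pi> ` {i<..n}"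
    proof (intro set_eqI iffI)
      fix x assume x: "x \<in> {1..<\<pi> i}"
      have "\<pi> i \<in> {1..n}" using True permutes_in_image[OF assms(1)] by blast
      then have "x \<in> {1..n}" using x by auto
      then obtain j where j: "j \<in> {1..n}" "x = \<pi> j"
        using permutes_image[OF assms(1)] by blast
      moreover have "i < j"
        using j x less[OF j(1), of i] True by (cases i j rule: linorder_cases) auto
      ultimately show "x \<in> \<pi> ` {i<..n}" by auto
    next
      fix x assume "x \<in> \<pi> ` {i<..n}"
      then obtain j where "j \<in> {i<..n}" "x = \<pi> j" by blast
      moreover from this have "\<pi> j \<in> {1..n}"
        using permutes_in_image[OF assms(1), of j] True by auto
      ultimately show "x \<in> {1..<\<pi> i}" using less[OF True] by auto
    qed
    then have "\<pi> i - 1 = n - i"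
      using card_image[OF inj_on_subset[OF permutes_inj[OF assms(1)]], of "{i<..n}"]
      by (metis card_atLeastLessThan card_greaterThanAtMost top_greatest)
    moreover have "1 \<le> \<pi> i" using True permutes_in_image[OF assms(1), of i] by auto
    ultimately show ?thesis using True by (simp add: rev_perm_def Suc_diff_le)
  qed
qed

section \<open>Words, their permutations and reduced words\<close>

lemma transpose_permutes: "i \<in> {1..<n} \<Longrightarrow> transpose i (Suc i) permutes {1..n}"
  by (intro permutes_swap_id) auto

lemma word_perm_Cons: "word_perm (a # w) = transpose a (Suc a) \<circ> word_perm w"
  by (simp add: word_perm_def)

lemma word_perm_permutes: "set w \<subseteq> {1..<n} \<Longrightarrow> word_perm w permutes {1..n}"
proof (induction w)
  case Nil
  have "word_perm [] = id" by (simp add: word_perm_def)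
  then show ?case using permutes_id by metis
next
  case (Cons a w)
  then have "word_perm w permutes {1..n}" "transpose a (Suc a) permutes {1..n}"
    using transpose_permutes[of a n] by simp_all
  then show ?case unfolding word_perm_Cons by (rule permutes_compose)
qed

lemma perm_code_inv_word:
  assumes "\<pi> permutes {1..n}" "set w \<subseteq> {1..<n}"
  shows "perm_code n (\<pi> \<circ> inv (word_perm w)) = foldr code_act w (perm_code n \<pi>)"
  using assms(2)
proof (induction w)
  case Nil
  show ?case by (simp add: word_perm_def)
next
  case (Cons a w)
  have w: "word_perm w permutes {1..n}" using word_perm_permutes Cons.prems by simp
  have "inv (word_perm (a # w)) = inv (word_perm w) \<circ> transpose a (Suc a)"
    unfolding word_perm_Cons using permutes_bij[OF w] by (simp add: o_inv_distrib)
  then have step: "perm_code n (\<pi> \<circ> inv (word_perm (a # w))) = code_act a (perm_code n (\<pi> \<circ> inv (word_perm w)))"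
    using perm_code_transpose[of "\<pi> \<circ> inv (word_perm w)" n a] Cons.prems
      permutes_compose[OF permutes_inv[OF w] assms(1)] by (simp add: comp_assoc)
  have "perm_code n (\<pi> \<circ> inv (word_perm w)) = foldr code_act w (perm_code n \<pi>)"
    using Cons.prems by (intro Cons.IH) simp
  then show ?case unfolding step by simp
qed

lemma perm_code_word:
  assumes "\<pi> permutes {1..n}" "set w \<subseteq> {1..<n}"
  shows "perm_code n (\<pi> \<circ> word_perm w) = fold code_act w (perm_code n \<pi>)"
  using assms
proof (induction w arbitrary: \<pi>)
  case Nil
  show ?case by (simp add: word_perm_def)
next
  case (Cons a w)
  have a: "a \<in> {1..<n}" using Cons.prems(2) by simp
  have \<pi>: "\<pi> \<circ> transpose a (Suc a) permutes {1..n}"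
    using permutes_compose[OF transpose_permutes[OF a] Cons.prems(1)] .
  then have "perm_code n ((\<pi> \<circ> transpose a (Suc a)) \<circ> word_perm w) =
      fold code_act w (perm_code n (\<pi> \<circ> transpose a (Suc a)))"
    using Cons.prems by (intro Cons.IH[OF \<pi>]) simp
  then show ?case
    by (simp only: word_perm_Cons comp_assoc fold_simps perm_code_transpose[OF Cons.prems(1) a])
qed

lemma fold_foldr_act: "fold code_act w (foldr code_act w c) = c"
  by (induction w arbitrary: c) simp_all

text \<open>The inverse turns a letter put in front of a word, the outermost divided difference,
  into a right multiplication, which \<open>code_act\<close> describes.\<close>

definition code_of :: "nat \<Rightarrow> (nat \<Rightarrow> nat) \<Rightarrow> nat \<Rightarrow> nat"
  where "code_of n u = perm_code n (rev_perm n \<circ> inv u)"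

lemma code_of_word: "set w \<subseteq> {1..<n} \<Longrightarrow> code_of n (word_perm w) = foldr code_act w (staircase n)"
  using perm_code_inv_word[OF rev_perm_permutes] by (simp add: code_of_def perm_code_rev_perm)

text \<open>Multiplying by the word undoes its action on the code, leading back to the staircase and
  so to the longest element. Cancelling that element leaves
  \<open>inv u \<circ> word_perm w = id\<close>.\<close>

lemma word_perm_eqI:
  assumes "u permutes {1..n}" "set w \<subseteq> {1..<n}" "code_of n u = foldr code_act w (staircase n)"
  shows "word_perm w = u"
proof -
  let ?\<pi> = "rev_perm n \<circ> inv u"
  have \<pi>: "?\<pi> permutes {1..n}"
    using permutes_compose[OF permutes_inv[OF assms(1)] rev_perm_permutes] .
  have "perm_code n (?\<pi> \<circ> word_perm w) = staircase n"
    using perm_code_word[OF \<pi> assms(2)] assms(3) fold_foldr_act by (simp add: code_of_def)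
  then have "?\<pi> \<circ> word_perm w = rev_perm n"
    using perm_code_eq_staircase permutes_compose[OF word_perm_permutes[OF assms(2)] \<pi>] by blast
  then have "inv u (word_perm w x) = x" for x
    using permutes_inj[OF rev_perm_permutes] by (metis comp_apply injD)
  then show ?thesis using permutes_inverses(1)[OF assms(1)] by (metis ext)
qed

lemma letters_eq: "{1..n - 1} = {1..<n}" for n :: nat
  by auto

text \<open>Some word for \<open>u\<close> has length equal to the deficit of its code, and no word
  for \<open>u\<close> is shorter. Whatever reduced word the choice operator picks thus has this
  length, and \<open>is_schubert_foldr\<close> applies to it.\<close>

lemma is_schubert_div_diff_perm:
  assumes "u permutes {1..n}"
  shows "is_schubert n (code_of n u) (div_diff_perm n u (schubert_w0 n))"
proof -
  obtain w where w: "set w \<subseteq> {1..<n}" "foldr code_act w (staircase n) = code_of n u"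
      "code_sum n (code_of n u) + length w = code_sum n (staircase n)"
    using code_word_exists[of n "code_of n u"] is_code_perm_code by (auto simp: code_of_def)
  have long: "code_sum n (staircase n) \<le> code_sum n (code_of n u) + length w'"
    if "set w' \<subseteq> {1..<n}" "word_perm w' = u" for w'
    using code_sum_foldr_act[OF that(1)] code_of_word[OF that(1)] that(2) by simp
  have "word_perm w = u" using word_perm_eqI[OF assms w(1)] w(2) by simp
  then have "reduced_word n u w"
    unfolding reduced_word_def letters_eq using w(1,3) long by fastforce
  define v where "v = (SOME w. reduced_word n u w)"
  have "reduced_word n u v"
    unfolding v_def using \<open>reduced_word n u w\<close> by (rule someI)
  then have v: "set v \<subseteq> {1..<n}" "word_perm v = u" "length v \<le> length w"
    unfolding reduced_word_def letters_eq using w(1) \<open>word_perm w = u\<close> by auto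
  have "foldr code_act v (staircase n) = code_of n u"
    using code_of_word[OF v(1)] v(2) by simp
  then show ?thesis
    using is_schubert_foldr[OF v(1)] long[OF v(1,2)] v(3) w(3)
    by (simp add: div_diff_perm_def v_def)
qed

lemma has_leading_mon_unique:
  assumes "has_leading_mon n f U" "has_leading_mon n f V"
  shows "U = V"
proof (rule ccontr)
  have asym: "asym {(a, b). a < (b :: nat)}" by (auto intro: asymI)
  assume "U \<noteq> V"
  then have "mon_less n U V" "mon_less n V U"
    using assms by (auto simp: has_leading_mon_def)
  then show False
    unfolding mon_less_def using lexord_asymmetric[OF asym] by blast
qed

text \<open>Resolves the definite description: a permutation with code \<open>expo W\<close> exists,
  and any candidate has this code by uniqueness of leading monomials, so
  \<open>word_perm_eqI\<close> identifies it.\<close>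

lemma is_schubert_schubert:
  assumes "W \<in> B_x n" "n \<ge> 1"
  shows "is_schubert n (expo W) (schubert n W)"
proof -
  have code: "is_code n (expo W)" using assms(1) B_x_iff by blast
  obtain w where w: "set w \<subseteq> {1..<n}" "foldr code_act w (staircase n) = expo W"
    using code_word_exists[OF code] by blast
  let ?u = "word_perm w"
  have u: "?u permutes {1..n}" "code_of n ?u = expo W"
    using word_perm_permutes code_of_word w by auto
  have "schubert_perm n W = ?u"
    unfolding schubert_perm_def
  proof (rule the_equality)
    show "?u permutes {1..n} \<and> has_leading_mon n (div_diff_perm n ?u (schubert_w0 n)) W"
      using is_schubert_has_leading_mon is_schubert_div_diff_perm[OF u(1)] u assms(2) by simp
  next
    fix u' assume u': "u' permutes {1..n} \<and> has_leading_mon n (div_diff_perm n u' (schubert_w0 n)) W"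
    have "is_code n (code_of n u')" by (simp add: code_of_def is_code_perm_code)
    then have le: "code_of n u' j \<le> staircase n j" for j by (simp add: is_code_def)
    have "j \<le> n" if "code_of n u' j \<noteq> 0" for j
      using le[of j] that by (simp add: staircase_def split: if_splits)
    \<comment> \<open>Finite support allows the code to be regarded as a monomial.\<close>
    then have "{j. code_of n u' j \<noteq> 0} \<subseteq> {..n}" by blast
    then have "finite {j. code_of n u' j \<noteq> 0}"
      using finite_subset finite_atMost by blast
    then have expo: "expo (Abs_poly_mapping (code_of n u')) = code_of n u'"
      by (rule lookup_Abs_poly_mapping)
    have "has_leading_mon n (div_diff_perm n u' (schubert_w0 n)) (Abs_poly_mapping (code_of n u'))"
      using is_schubert_has_leading_mon is_schubert_div_diff_perm u' assms(2) expo by metis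
    then have "code_of n u' = expo W" using has_leading_mon_unique u' expo by metis
    then show "u' = ?u" using word_perm_eqI[of u' n w] u' w by simp
  qed
  then show ?thesis using is_schubert_div_diff_perm[OF u(1)] u(2) by (simp add: schubert_def)
qed

section \<open>The construction\<close>

lemma pivot_properties:
  assumes "t + 2 \<le> n"
  shows "pivot n t W \<in> {t + 1..n - 1}" "expo W (pivot n t W) + pivot n t W = max_height n t W"
    "\<And>l. l \<in> {t + 1..n - 1} \<Longrightarrow> expo W l + l \<le> max_height n t W"
    "\<And>l. l \<in> {t + 1..<pivot n t W} \<Longrightarrow> expo W l + l < max_height n t W"
proof -
  have "max_height n t W \<in> (\<lambda>l. expo W l + l) ` {t + 1..n - 1}"
    unfolding max_height_def using assms by (intro Max_in) auto
  then have "\<exists>k. k \<in> {t + 1..n - 1} \<and> expo W k + k = max_height n t W" by auto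
  then have k: "pivot n t W \<in> {t + 1..n - 1} \<and> expo W (pivot n t W) + pivot n t W = max_height n t W"
    unfolding pivot_def by (rule LeastI_ex)
  then show "pivot n t W \<in> {t + 1..n - 1}" "expo W (pivot n t W) + pivot n t W = max_height n t W"
    by auto
  show le: "expo W l + l \<le> max_height n t W" if "l \<in> {t + 1..n - 1}" for l
    unfolding max_height_def using that by (intro Max_ge) auto
  show "expo W l + l < max_height n t W" if "l \<in> {t + 1..<pivot n t W}" for l
  proof -
    have "l \<in> {t + 1..n - 1}" using that k by auto
    moreover have "\<not> (l \<in> {t + 1..n - 1} \<and> expo W l + l = max_height n t W)"
      using that unfolding pivot_def by (intro not_less_Least) simp
    ultimately show ?thesis using le[of l] by auto
  qed
qed

lemma expo_step_mon:
  assumes "W \<in> B_x n" "t + 2 \<le> n"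
  shows "expo (step_mon n t W) j =
    (if j = t + 1 then max_height n t W - t - 1
     else if t + 1 < j \<and> j \<le> pivot n t W then expo W (j - 1) else expo W j)"
proof -
  let ?k = "pivot n t W"
  have k: "t + 1 \<le> ?k" "?k \<le> n - 1" using pivot_properties(1)[OF assms(2), of W] by auto
  have "expo W j = 0" if "j \<notin> {1..n - 1}"
    using assms(1) that by (auto simp: B_x_def in_keys_iff)
  then show ?thesis
    using k pivot_properties(2)[OF assms(2), of W]
    by (auto simp: step_mon_def Let_def lookup_add lookup_single lookup_sum_var_pow when_def)
qed

text \<open>Entries before the pivot have height strictly below the maximum, which is at most
  \<open>n\<close>, so moving them one place right keeps them within bounds.\<close>

lemma step_mon_in_B_x:
  assumes "W \<in> B_x n" "t + 2 \<le> n"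
  shows "step_mon n t W \<in> B_x n"
proof -
  let ?k = "pivot n t W"
  note k = pivot_properties[OF assms(2), where W = W]
  have le: "expo W j \<le> staircase n j" for j
    using assms(1) by (simp add: B_x_iff is_code_def)
  have max: "max_height n t W \<le> n"
    using le[of ?k] k(1,2) assms(2) by (auto simp: staircase_def)
  have "expo (step_mon n t W) j \<le> staircase n j" for j
  proof -
    have "expo W (j - 1) + (j - 1) < max_height n t W" if "t + 1 < j" "j \<le> ?k"
      using that by (intro k(4)) auto
    then show ?thesis
      using le[of j] max by (auto simp: expo_step_mon[OF assms] staircase_def)
  qed
  then show ?thesis by (simp add: B_x_iff is_code_def)
qed

text \<open>The shift of \<open>is_schubert_shift\<close> undoes \<open>step_mon\<close>: the entry
  at \<open>t + 1\<close> returns to the pivot. Minimality of the pivot makes the passed heights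
  strictly smaller in \<open>W\<close>, hence at most equal after their move, as the descents
  require.\<close>

lemma is_schubert_step:
  assumes "W \<in> B_x n" "t + 2 \<le> n" "is_schubert n (expo (step_mon n t W)) f"
  shows "is_schubert n (expo W) (div_diff_word (step_word n t W) f)"
proof -
  let ?k = "pivot n t W" and ?c = "expo (step_mon n t W)"
  note k = pivot_properties[OF assms(2), where W = W]
  note c = expo_step_mon[OF assms(1,2)]
  have bound: "?c j + j \<le> ?c (t + 1) + (t + 1)" if "t + 1 < j" "j \<le> ?k" for j
  proof -
    have "expo W (j - 1) + (j - 1) < max_height n t W"
      using that by (intro k(4)) auto
    then show ?thesis using that by (simp add: c)
  qed
  have "is_schubert n (shift_code (t + 1) ?k ?c)
    (foldr div_diff (rev [t + 1..<?k]) f)"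
    using k(1) assms(2) by (intro is_schubert_shift assms(3) bound) auto
  moreover have "shift_code (t + 1) ?k ?c = expo W"
    using k(1,2) by (auto simp: c fun_eq_iff)
  moreover have "step_word n t W = rev [t + 1..<?k]"
    using k(1) by (simp add: step_word_def desc_word_def)
  ultimately show ?thesis by (simp add: div_diff_word_def)
qed

text \<open>The new height at \<open>t + 1\<close> is the old maximum, and moved entries rise by one
  from strictly below it. The bound \<open>t + 3 \<le> n\<close> keeps the range of the new maximum
  nonempty.\<close>

lemma ordered_upto_step:
  assumes "W \<in> B_x n" "t + 3 \<le> n" "ordered_upto n t W"
  shows "ordered_upto n (Suc t) (step_mon n t W)"
proof -
  let ?k = "pivot n t W" and ?c = "expo (step_mon n t W)"
  have t: "t + 2 \<le> n" using assms(2) by simp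
  note k = pivot_properties[OF t, where W = W]
  note c = expo_step_mon[OF assms(1) t]
  have top: "?c (t + 1) + (t + 1) = max_height n t W"
    using k(1,2) by (simp add: c)
  have "?c (i + 1) + (i + 1) \<le> ?c i + i" if "i \<in> {1..<Suc t}" for i
  proof (cases "i = t")
    case True
    then show ?thesis using top assms(3) that by (simp add: ordered_upto_def c)
  next
    case False
    then show ?thesis using assms(3) that by (simp add: ordered_upto_def c)
  qed
  moreover have "max_height n (Suc t) (step_mon n t W) \<le> max_height n t W"
    unfolding max_height_def[of n "Suc t"]
  proof (rule Max.boundedI)
    fix x assume "x \<in> (\<lambda>l. ?c l + l) ` {Suc t + 1..n - 1}"
    then obtain l where l: "l \<in> {Suc t + 1..n - 1}" "x = ?c l + l" by blast
    show "x \<le> max_height n t W"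
    proof (cases "l \<le> ?k")
      case True
      then have "expo W (l - 1) + (l - 1) < max_height n t W"
        using l by (intro k(4)) auto
      then show ?thesis using True l by (simp add: c)
    next
      case False
      then show ?thesis using k(3)[of l] l by (simp add: c)
    qed
  qed (use assms(2) in auto)
  ultimately show ?thesis using top by (simp add: ordered_upto_def)
qed

lemma W_seq:
  assumes "W0 \<in> B_x n" "i + 2 \<le> n"
  shows "W_seq n W0 i \<in> B_x n \<and> ordered_upto n i (W_seq n W0 i)"
  using assms(2)
proof (induction i)
  case 0
  show ?case using assms(1) by (simp add: ordered_upto_def)
next
  case (Suc i)
  then show ?case using step_mon_in_B_x ordered_upto_step by simp
qed

lemma is_schubert_v_seq:
  assumes "W0 \<in> B_x n" "i + 2 \<le> n" "is_schubert n (expo (W_seq n W0 (Suc i))) f"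
  shows "is_schubert n (expo (W_seq n W0 i)) (div_diff_word (v_seq n W0 (Suc i)) f)"
  using is_schubert_step[of "W_seq n W0 i" n i f] W_seq[OF assms(1,2)] assms
  by (simp add: v_seq_def)

theorem lemma4p3:
  fixes n :: nat
  assumes "n \<ge> 2"
  shows
    "(\<forall>t\<in>{0..n - 2}. \<forall>W\<in>B_x n. ordered_upto n t W \<longrightarrow>
        step_mon n t W \<in> B_x n \<and>
        has_leading_mon n (div_diff_word (step_word n t W) (schubert n (step_mon n t W))) W)
     \<and>
     (\<forall>W0\<in>B_x n.
        (\<forall>i\<in>{0..n - 2}. W_seq n W0 i \<in> B_x n) \<and>
        (\<forall>i\<in>{1..n - 2}.
           has_leading_mon n (div_diff_word (v_seq n W0 i) (schubert n (W_seq n W0 i)))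
             (W_seq n W0 (i - 1))) \<and>
        has_leading_mon n
          (foldr (\<lambda>i. div_diff_word (v_seq n W0 i)) [1..<n - 1] (schubert n (W_seq n W0 (n - 2))))
          W0 \<and>
        (\<forall>i\<in>{0..n - 2}. ordered_upto n i (W_seq n W0 i)))"
proof (intro conjI ballI impI)
  fix t W assume t: "t \<in> {0..n - 2}" and W: "W \<in> B_x n"
  then have t2: "t + 2 \<le> n" using assms by auto
  show step: "step_mon n t W \<in> B_x n" using step_mon_in_B_x W t2 by blast
  show "has_leading_mon n (div_diff_word (step_word n t W) (schubert n (step_mon n t W))) W"
    using is_schubert_has_leading_mon is_schubert_step[OF W t2] is_schubert_schubert[OF step] assms
    by simp
next
  fix W0 assume W0: "W0 \<in> B_x n"
  have seq: "W_seq n W0 i \<in> B_x n" "ordered_upto n i (W_seq n W0 i)" if "i \<le> n - 2" for i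
    using W_seq[OF W0, of i] that assms by auto
  show "W_seq n W0 i \<in> B_x n" "ordered_upto n i (W_seq n W0 i)" if "i \<in> {0..n - 2}" for i
    using seq that by auto
  show "has_leading_mon n (div_diff_word (v_seq n W0 i) (schubert n (W_seq n W0 i))) (W_seq n W0 (i - 1))"
    if i_in: "i \<in> {1..n - 2}" for i
  proof -
    obtain i' where i: "i = Suc i'" using i_in by (cases i) auto
    have "is_schubert n (expo (W_seq n W0 i)) (schubert n (W_seq n W0 i))"
      using that assms by (intro is_schubert_schubert seq) auto
    then have "is_schubert n (expo (W_seq n W0 i')) (div_diff_word (v_seq n W0 i) (schubert n (W_seq n W0 i)))"
      unfolding i using that assms i by (intro is_schubert_v_seq[OF W0]) auto
    then show ?thesis using is_schubert_has_leading_mon assms i by simp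
  qed
  \<comment> \<open>The composite is followed through \<open>is_schubert\<close>, since leading
    monomials alone do not determine those of divided differences. The induction runs down from
    \<open>n - 2\<close>, where no operator is left, to 0.\<close>
  have "is_schubert n (expo (W_seq n W0 i))
      (foldr (\<lambda>i. div_diff_word (v_seq n W0 i)) [Suc i..<n - 1] (schubert n (W_seq n W0 (n - 2))))"
    if "i \<le> n - 2" for i
    using that
  proof (induction i rule: inc_induct)
    case base
    have "[Suc (n - 2)..<n - 1] = []" using assms by simp
    then show ?case using is_schubert_schubert seq assms by simp
  next
    case (step i)
    have "[Suc i..<n - 1] = Suc i # [Suc (Suc i)..<n - 1]"
      using step.hyps by (intro upt_conv_Cons) simp
    then show ?case using is_schubert_v_seq[OF W0] step by simp
  qed
  from this[of 0] show "has_leading_mon n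
      (foldr (\<lambda>i. div_diff_word (v_seq n W0 i)) [1..<n - 1] (schubert n (W_seq n W0 (n - 2)))) W0"
    using is_schubert_has_leading_mon assms by simp
qed

end
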